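(* Let $\Psi=\{f_1,\dots,f_N\}$ be a system of contracting similitudes of $\mathbb{R}^n$ satisfying the strong separation condition, with self-similar set $E$, similarity dimension $s$, minimal ratio $r_{\min}$ and separation constant $c$. Then for every $a\in\left(0,\frac{c}{r_{\min}}\right]$, $$P^s(E)=\max\{h(x,d): x\in E,\ 0<d\le a\}=\max\{h(x,d): x\in E,\ a r_{\min}\le d\le a\},$$ where both maxima are attained.
   Context: Setting: $\Psi=\{f_1,\dots,f_N\}$, $N\ge 2$, is a system of contracting similitudes of $\mathbb{R}^n$ with ratios $r_1,\dots,r_N\in(0,1)$, i.e. $|f_i(x)-f_i(y)|=r_i|x-y|$. $E$ is the unique nonempty compact set with $E=\bigcup_{i=1}^N f_i(E)$. The strong separation condition (SSC) means $f_i(E)\cap f_j(E)=\emptyset$ for all $i\ne j$. Write $r_{\min}=\min_i r_i$ and $c=\min_{i\neq j}\operatorname{dist}(f_i(E),f_j(E))>0$, where $\operatorname{dist}$ of two sets is the infimum of distances between their points. The similarity dimension $s$ is the unique solution of $\sum_{i=1}^N r_i^s=1$. The natural measure $\mu$ is the unique Borel probability measure on $E$ with $\mu(f_{i_1}\circ\cdots\circ f_{i_k}(E))=(r_{i_1}\cdots r_{i_k})^s$ for all finite words $i_1\dots i_k$ over $\{1,\dots,N\}$. $B(x,d)$ is the closed Euclidean ball of center $x$ and radius $d$. For $x\in E$, $d>0$, $h(x,d)=\frac{(2d)^s}{\mu(B(x,d))}$. Packing measure: for $A\subset\mathbb{R}^n$, $P^s_\delta(A)=\sup\sum_i|B_i|^s$,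 the supremum over all countable families of pairwise disjoint closed Euclidean balls $B_i$ centered at points of $A$ with diameters $|B_i|\le\delta$; $P^s_0(A)=\lim_{\delta\to0}P^s_\delta(A)$; and $P^s(A)=\inf\{\sum_{i=1}^\infty P_0^s(U_i): A\subset\bigcup_{i=1}^\infty U_i\}$. *)

theory Defs
  imports "HOL-Probability.Probability"
begin

section \<open>Packing measure\<close>

definition centered_packing :: "real \<Rightarrow> 'a::metric_space set \<Rightarrow> 'a set set \<Rightarrow> bool" where
  "centered_packing \<delta> A \<B> \<longleftrightarrow>
     countable \<B> \<and> disjoint \<B> \<and>
     (\<forall>B\<in>\<B>. (\<exists>x\<in>A. \<exists>\<rho>>0. B = cball x \<rho>) \<and> diameter B \<le> \<delta>)"

definition packing_pre_delta :: "real \<Rightarrow> real \<Rightarrow> 'a::metric_space set \<Rightarrow> ennreal" where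
  "packing_pre_delta s \<delta> A =
     (SUP \<B>\<in>{\<B>. centered_packing \<delta> A \<B>}. \<Sum>\<^sub>\<infinity>B\<in>\<B>. ennreal (diameter B powr s))"

definition packing_premeasure :: "real \<Rightarrow> 'a::metric_space set \<Rightarrow> ennreal" where
  "packing_premeasure s A = Lim (at_right 0) (\<lambda>\<delta>. packing_pre_delta s \<delta> A)"

definition packing_measure :: "real \<Rightarrow> 'a::metric_space set \<Rightarrow> ennreal" where
  "packing_measure s A =
     (INF U\<in>{U :: nat \<Rightarrow> 'a set. A \<subseteq> (\<Union>i. U i)}. \<Sum>i. packing_premeasure s (U i))"

text \<open>The limit defining the premeasure exists, so the value of \<^const>\<open>Lim\<close> is meaningful.\<close>

lemma packing_pre_delta_mono:
  assumes "\<delta> \<le> \<delta>'"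
  shows "packing_pre_delta s \<delta> A \<le> packing_pre_delta s \<delta>' A"
proof -
  have "{\<B>. centered_packing \<delta> A \<B>} \<subseteq> {\<B>. centered_packing \<delta>' A \<B>}"
    using assms unfolding centered_packing_def by fastforce
  then show ?thesis
    unfolding packing_pre_delta_def by (rule SUP_subset_mono) simp
qed

lemma packing_pre_delta_tendsto:
  "((\<lambda>\<delta>. packing_pre_delta s \<delta> A) \<longlongrightarrow> packing_premeasure s A) (at_right 0)"
proof -
  let ?L = "INF \<delta>\<in>{0<..}. packing_pre_delta s \<delta> A"
  have *: "((\<lambda>\<delta>. packing_pre_delta s \<delta> A) \<longlongrightarrow> ?L) (at_right 0)"
  proof (rule order_tendstoI)
    fix y assume "y < ?L"
    then have "\<forall>\<delta>>0. y < packing_pre_delta s \<delta> A"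
      by (meson INF_lower greaterThan_iff less_le_trans)
    then show "eventually (\<lambda>\<delta>. y < packing_pre_delta s \<delta> A) (at_right 0)"
      unfolding eventually_at_right_field by (metis zero_less_one)
  next
    fix y assume "?L < y"
    then obtain d where d: "d > 0" "packing_pre_delta s d A < y"
      by (auto simp: INF_less_iff)
    then show "eventually (\<lambda>\<delta>. packing_pre_delta s \<delta> A < y) (at_right 0)"
      unfolding eventually_at_right_field
      by (meson le_less_trans less_imp_le packing_pre_delta_mono)
  qed
  then have "packing_premeasure s A = ?L"
    unfolding packing_premeasure_def by (intro tendsto_Lim) auto
  with * show ?thesis by simp
qed

section \<open>Self-similar sets\<close>

definition similitude_system ::
  "nat \<Rightarrow> (nat \<Rightarrow> 'a::metric_space \<Rightarrow> 'a) \<Rightarrow> (nat \<Rightarrow> real) \<Rightarrow> bool" where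
  "similitude_system N f r \<longleftrightarrow>
     N \<ge> 2 \<and>
     (\<forall>i\<in>{1..N}. 0 < r i \<and> r i < 1 \<and> (\<forall>x y. dist (f i x) (f i y) = r i * dist x y))"

text \<open>The next three notions are predicates: the set, the exponent and the measure with the
  stated property are unique for the systems considered here.\<close>

definition self_similar_set ::
  "nat \<Rightarrow> (nat \<Rightarrow> 'a::metric_space \<Rightarrow> 'a) \<Rightarrow> 'a set \<Rightarrow> bool" where
  "self_similar_set N f E \<longleftrightarrow> E \<noteq> {} \<and> compact E \<and> E = (\<Union>i\<in>{1..N}. f i ` E)"

definition similarity_dimension :: "nat \<Rightarrow> (nat \<Rightarrow> real) \<Rightarrow> real \<Rightarrow> bool" where
  "similarity_dimension N r s \<longleftrightarrow> (\<Sum>i=1..N. r i powr s) = 1"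

definition natural_measure ::
  "nat \<Rightarrow> (nat \<Rightarrow> 'a::metric_space \<Rightarrow> 'a) \<Rightarrow> (nat \<Rightarrow> real) \<Rightarrow> real \<Rightarrow> 'a set \<Rightarrow> 'a measure \<Rightarrow> bool" where
  "natural_measure N f r s E \<mu> \<longleftrightarrow>
     prob_space \<mu> \<and> sets \<mu> = sets borel \<and> emeasure \<mu> E = 1 \<and>
     (\<forall>w\<in>lists {1..N}.
        emeasure \<mu> (foldr (\<lambda>i g. f i \<circ> g) w id ` E) = ennreal (prod_list (map r w) powr s))"

definition strong_separation ::
  "nat \<Rightarrow> (nat \<Rightarrow> 'a \<Rightarrow> 'a) \<Rightarrow> 'a set \<Rightarrow> bool" where
  "strong_separation N f E \<longleftrightarrow>
     (\<forall>i\<in>{1..N}. \<forall>j\<in>{1..N}. i \<noteq> j \<longrightarrow> f i ` E \<inter> f j ` E = {})"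

definition min_ratio :: "nat \<Rightarrow> (nat \<Rightarrow> real) \<Rightarrow> real" where
  "min_ratio N r = Min (r ` {1..N})"

definition separation_const ::
  "nat \<Rightarrow> (nat \<Rightarrow> 'a::metric_space \<Rightarrow> 'a) \<Rightarrow> 'a set \<Rightarrow> real" where
  "separation_const N f E =
     Min {setdist (f i ` E) (f j ` E) | i j. i \<in> {1..N} \<and> j \<in> {1..N} \<and> i \<noteq> j}"

definition inv_density :: "'a::metric_space measure \<Rightarrow> real \<Rightarrow> 'a \<Rightarrow> real \<Rightarrow> real" where
  "inv_density \<mu> s x d = (2 * d) powr s / measure \<mu> (cball x d)"

definition is_maximum :: "'a::order set \<Rightarrow> 'a \<Rightarrow> bool" where
  "is_maximum S m \<longleftrightarrow> m \<in> S \<and> (\<forall>y\<in>S. y \<le> m)"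

end

theory Submission
  imports Defs
begin

text \<open>Pulling a ball back by a similitude of the system shows
  \<open>h (f i x) (r i * d) \<le> h x d\<close>, with equality when the ball around \<open>f i x\<close> meets \<open>E\<close> only inside
  \<open>f i ` E\<close>; this reduces all radii \<open>\<le> a\<close> to the annulus \<open>[a * rmin, a]\<close> and, if
  \<open>d \<le> c / rmin\<close>, pushes values of \<open>h\<close> down to arbitrarily small scales. The maximum on the annulus
  exists because spheres are null for the natural measure, so that \<open>h\<close> is continuous. For a packing
  by balls of radius \<open>\<le> a\<close> one has \<open>(2 d) powr s \<le> M * \<mu> B\<close> for each ball, which gives the upper
  bound. For the lower bound, small similar copies of a near-optimal ball, recentred in \<open>A \<subseteq> E\<close>,
  form a Vitali-type family exhausting \<open>closure A\<close> in measure, so the premeasure of \<open>A\<close> is at least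
  \<open>h x d * \<mu> (closure A)\<close>.\<close>

section \<open>Packing premeasures\<close>

text \<open>Two obstacles shape the proof. First, nothing obvious prevents \<open>\<mu>\<close> from
  charging a sphere. The maps pull spheres back to spheres, so one bound 1 - e valid for all spheres
  passes to every cylinder and contradicts outer regularity. That uniform bound is a compactness
  statement, delicate because spheres can degenerate to hyperplanes and E may itself lie in a
  hyperplane. Second, the covers in the packing measure consist of arbitrary sets, possibly not
  measurable, in which the balls must be centred. Hence closures replace the sets in the estimates,
  and centres are moved slightly; the displacement is paid for by replacing the radius d by D < d in
  the numerator of h while keeping the measure of the larger ball in the denominator. The bound
  \<open>c / rmin\<close> is what a single map of ratio \<open>rmin\<close> requires: it sends
  smaller radii below c, where a ball centred in one first-level piece meets E only inside that
  piece.\<close>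

lemma packing_pre_delta_mono_set:
  assumes "A \<subseteq> B"
  shows "packing_pre_delta s \<delta> A \<le> packing_pre_delta s \<delta> B"
proof -
  have "{\<B>. centered_packing \<delta> A \<B>} \<subseteq> {\<B>. centered_packing \<delta> B \<B>}"
    using assms unfolding centered_packing_def by blast
  then show ?thesis
    unfolding packing_pre_delta_def by (rule SUP_subset_mono) simp
qed

lemma packing_premeasure_mono:
  assumes "A \<subseteq> B"
  shows "packing_premeasure s A \<le> packing_premeasure s B"
  by (rule tendsto_le[OF _ packing_pre_delta_tendsto packing_pre_delta_tendsto])
     (simp_all add: packing_pre_delta_mono_set assms)

lemma packing_premeasure_le:
  assumes "0 < \<delta>"
  shows "packing_premeasure s A \<le> packing_pre_delta s \<delta> A"
proof (rule tendsto_upperbound[OF packing_pre_delta_tendsto])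
  have "eventually (\<lambda>t. t < \<delta>) (at_right (0::real))"
    using assms by (auto simp: eventually_at_right_field)
  then show "eventually (\<lambda>t. packing_pre_delta s t A \<le> packing_pre_delta s \<delta> A) (at_right 0)"
    by eventually_elim (rule packing_pre_delta_mono, simp)
qed simp

lemma packing_premeasure_ge:
  assumes "\<And>\<delta>. 0 < \<delta> \<Longrightarrow> b \<le> packing_pre_delta s \<delta> A"
  shows "b \<le> packing_premeasure s A"
proof (rule tendsto_lowerbound[OF packing_pre_delta_tendsto])
  show "eventually (\<lambda>t. b \<le> packing_pre_delta s t A) (at_right 0)"
    using assms by (auto simp: eventually_at_right_field intro: exI[of _ 1])
qed simp

lemma packing_premeasure_empty: "packing_premeasure s ({} :: 'a::metric_space set) = 0"
proof -
  have "packing_pre_delta s 1 ({} :: 'a set) \<le> 0" unfolding packing_pre_delta_def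
  proof (rule SUP_least)
    fix \<B> :: "'a set set" assume "\<B> \<in> {\<B>. centered_packing 1 {} \<B>}"
    then have "\<B> = {}" by (auto simp: centered_packing_def)
    then show "(\<Sum>\<^sub>\<infinity>B\<in>\<B>. ennreal (diameter B powr s)) \<le> 0" by simp
  qed
  then show ?thesis using packing_premeasure_le[of 1 s "{} :: 'a set"] by simp
qed

lemma packing_measure_le_premeasure: "packing_measure s A \<le> packing_premeasure s A"
proof -
  let ?U = "\<lambda>i. if i = (0::nat) then A else {}"
  have "packing_measure s A \<le> (\<Sum>i. packing_premeasure s (?U i))"
    unfolding packing_measure_def by (intro INF_lower) (auto intro: exI[of _ 0])
  also have "\<dots> = (\<Sum>i\<in>{0}. packing_premeasure s (?U i))"
    by (intro suminf_finite) (auto simp: packing_premeasure_empty)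
  finally show ?thesis by simp
qed

text \<open>Source of all slack: p is the measure of the larger ball, and the gap d - D either
  absorbs a displacement of the centre or makes a non-strict bound on the radius strict.\<close>

lemma powr_divide_gt_shrink:
  fixes H s p d :: real
  assumes "H < (2 * d) powr s / p" "0 < p" "0 < d"
  obtains D where "0 < D" "D < d" "H < (2 * D) powr s / p"
proof -
  have "((\<lambda>t. (2 * t) powr s / p) \<longlongrightarrow> (2 * d) powr s / p) (at_left d)"
    using assms by (intro tendsto_intros) auto
  then have "eventually (\<lambda>t. H < (2 * t) powr s / p) (at_left d)"
    using assms(1) by (rule order_tendstoD)
  moreover have "eventually (\<lambda>t. t \<in> {0<..<d}) (at_left d)"
    using assms(3) by (rule eventually_at_leftI[rotated]) simp
  ultimately have "eventually (\<lambda>t. H < (2 * t) powr s / p \<and> t \<in> {0<..<d}) (at_left d)"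
    by (rule eventually_conj)
  then have "\<exists>t. H < (2 * t) powr s / p \<and> t \<in> {0<..<d}"
    by (rule eventually_happens'[rotated]) simp
  then show thesis using that by auto
qed

section \<open>Cylinders\<close>

locale separated_ifs =
  fixes N :: nat and f :: "nat \<Rightarrow> 'a::euclidean_space \<Rightarrow> 'a" and r :: "nat \<Rightarrow> real"
    and E :: "'a set"
  assumes similitudes: "similitude_system N f r"
    and self_similar: "self_similar_set N f E"
    and separated: "strong_separation N f E"
begin

definition "letters = {1..N}"
definition "words = lists letters"
abbreviation "c \<equiv> separation_const N f E"
abbreviation "rmin \<equiv> min_ratio N r"

definition word_map :: "nat list \<Rightarrow> 'a \<Rightarrow> 'a" where
  "word_map w = foldr (\<lambda>i g. f i \<circ> g) w id"

definition cyl :: "nat list \<Rightarrow> 'a set" where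
  "cyl w = word_map w ` E"

definition ratio :: "nat list \<Rightarrow> real" where
  "ratio w = prod_list (map r w)"

lemma words_Nil [simp]: "[] \<in> words"
  and words_Cons [simp]: "i # w \<in> words \<longleftrightarrow> i \<in> letters \<and> w \<in> words"
  and words_append [simp]: "v @ w \<in> words \<longleftrightarrow> v \<in> words \<and> w \<in> words"
  by (auto simp: words_def)

lemma words_induct [consumes 1, case_names Nil Cons]:
  assumes "w \<in> words" "P []"
    "\<And>i w. i \<in> letters \<Longrightarrow> w \<in> words \<Longrightarrow> P w \<Longrightarrow> P (i # w)"
  shows "P w"
  using assms by (induction w) auto

lemma finite_letters: "finite letters"
  by (simp add: letters_def)

lemma N_ge_2: "N \<ge> 2"
  using similitudes by (simp add: similitude_system_def)

lemma r_pos: "i \<in> letters \<Longrightarrow> 0 < r i" and r_less_1: "i \<in> letters \<Longrightarrow> r i < 1"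
  and dist_f: "i \<in> letters \<Longrightarrow> dist (f i x) (f i y) = r i * dist x y"
  using similitudes by (auto simp: similitude_system_def letters_def)

lemma E_nonempty: "E \<noteq> {}" and compact_E: "compact E" and E_eq: "E = (\<Union>i\<in>letters. f i ` E)"
  using self_similar by (auto simp: self_similar_set_def letters_def)

lemma f_in_E: "i \<in> letters \<Longrightarrow> x \<in> E \<Longrightarrow> f i x \<in> E"
  using E_eq by blast

lemma E_obtain:
  assumes "x \<in> E" obtains i y where "i \<in> letters" "y \<in> E" "x = f i y"
  using assms E_eq by blast

lemma word_map_Nil [simp]: "word_map [] = id"
  and word_map_Cons [simp]: "word_map (i # w) = f i \<circ> word_map w"
  by (simp_all add: word_map_def)

lemma word_map_append: "word_map (v @ w) = word_map v \<circ> word_map w"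
  by (induction v) auto

lemma ratio_Nil [simp]: "ratio [] = 1"
  and ratio_Cons [simp]: "ratio (i # w) = r i * ratio w"
  by (simp_all add: ratio_def)

lemma ratio_append: "ratio (v @ w) = ratio v * ratio w"
  by (induction v) auto

lemma ratio_pos: "w \<in> words \<Longrightarrow> 0 < ratio w"
  by (induction w rule: words_induct) (simp_all add: r_pos)

lemma ratio_le_1: "w \<in> words \<Longrightarrow> ratio w \<le> 1"
proof (induction w rule: words_induct)
  case (Cons i w)
  then show ?case
    using r_pos[of i] r_less_1[of i] ratio_pos[of w] mult_le_one[of "r i" "ratio w"] by simp
qed simp

lemma dist_word_map: "w \<in> words \<Longrightarrow> dist (word_map w x) (word_map w y) = ratio w * dist x y"
  by (induction w rule: words_induct) (simp_all add: dist_f)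

lemma inj_word_map: "w \<in> words \<Longrightarrow> inj (word_map w)"
  using dist_word_map[of w] ratio_pos[of w] by (intro injI) (metis dist_eq_0_iff less_irrefl mult_eq_0_iff)

lemma inj_f: "i \<in> letters \<Longrightarrow> inj (f i)"
  using inj_word_map[of "[i]"] by simp

lemma cyl_Nil [simp]: "cyl [] = E"
  by (simp add: cyl_def)

lemma cyl_Cons: "cyl (i # w) = f i ` cyl w"
  by (simp add: cyl_def image_comp)

lemma cyl_subset_E: "w \<in> words \<Longrightarrow> cyl w \<subseteq> E"
  by (induction w rule: words_induct) (auto simp: cyl_Cons intro: f_in_E)

lemma cyl_append: "cyl (v @ w) = word_map v ` cyl w"
  by (simp add: cyl_def word_map_append image_comp)

lemma cyl_append_subset: "w \<in> words \<Longrightarrow> cyl (v @ w) \<subseteq> cyl v"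
  unfolding cyl_append using cyl_subset_E[of w] by (auto simp: cyl_def)

lemma continuous_on_word_map: "w \<in> words \<Longrightarrow> continuous_on S (word_map w)"
  by (rule lipschitz_on_continuous_on[of "ratio w"])
     (auto intro!: lipschitz_onI simp: dist_word_map ratio_pos less_imp_le)

lemma compact_cyl: "w \<in> words \<Longrightarrow> compact (cyl w)"
  unfolding cyl_def by (intro compact_continuous_image continuous_on_word_map compact_E)

lemma E_Union_cyl:
  assumes "x \<in> E"
  obtains w where "w \<in> words" "length w = m" "x \<in> cyl w"
proof -
  have "\<exists>w\<in>words. length w = m \<and> x \<in> cyl w" using assms
  proof (induction m arbitrary: x)
    case (Suc m)
    obtain i y where iy: "i \<in> letters" "y \<in> E" "x = f i y"
      using Suc.prems by (rule E_obtain)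
    then obtain w where "w \<in> words" "length w = m" "y \<in> cyl w" using Suc.IH by blast
    then show ?case using iy by (intro bexI[of _ "i # w"]) (auto simp: cyl_Cons)
  qed (auto intro: bexI[of _ "[]"])
  then show thesis using that by blast
qed

lemma rmin_le: "i \<in> letters \<Longrightarrow> rmin \<le> r i"
  by (simp add: min_ratio_def letters_def)

lemma rmin_attained: obtains i where "i \<in> letters" "r i = rmin"
proof -
  have "rmin \<in> r ` letters" unfolding min_ratio_def letters_def using N_ge_2 by (intro Min_in) auto
  then show thesis using that by auto
qed

lemma rmin_pos: "0 < rmin" and rmin_less_1: "rmin < 1"
  by (rule rmin_attained, use r_pos r_less_1 in force)+

lemma rmax_exists:
  obtains q where "0 < q" "q < 1" "\<And>i. i \<in> letters \<Longrightarrow> r i \<le> q"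
proof
  let ?q = "Max (r ` letters)"
  have "?q \<in> r ` letters" using N_ge_2 by (intro Max_in) (auto simp: letters_def)
  then show "0 < ?q" "?q < 1" using r_pos r_less_1 by auto
qed (auto simp: finite_letters)

lemma long_words_small:
  assumes "0 < e"
  obtains m where "\<And>w. w \<in> words \<Longrightarrow> length w = m \<Longrightarrow> ratio w < e"
proof -
  obtain q where q: "0 < q" "q < 1" "\<And>i. i \<in> letters \<Longrightarrow> r i \<le> q" by (rule rmax_exists) blast
  have le: "ratio w \<le> q ^ length w" if "w \<in> words" for w using that
  proof (induction w rule: words_induct)
    case (Cons i w)
    then show ?case using q r_pos[of i] ratio_pos[of w] by (auto intro!: mult_mono)
  qed simp
  obtain m where "q ^ m < e" using real_arch_pow_inv[OF assms q(2)] by blast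
  show thesis
  proof (rule that[of m])
    fix w assume "w \<in> words" "length w = m"
    then show "ratio w < e" using le[of w] \<open>q ^ m < e\<close> by simp
  qed
qed

lemma diam_cyl:
  assumes "w \<in> words" "x \<in> cyl w" "y \<in> cyl w"
  shows "dist x y \<le> ratio w * diameter E"
  using assms diameter_bounded_bound[OF compact_imp_bounded[OF compact_E]] ratio_pos[OF assms(1)]
  by (auto simp: cyl_def dist_word_map intro!: mult_left_mono)

lemma diameter_E_nonneg: "0 \<le> diameter E"
  using diameter_ge_0[OF compact_imp_bounded[OF compact_E]] .

lemma long_cyl_small:
  assumes "0 < e" and "0 \<le> (b::real)"
  obtains m where "\<And>w. w \<in> words \<Longrightarrow> length w = m \<Longrightarrow> ratio w * b < e"
    "\<And>w x y. w \<in> words \<Longrightarrow> length w = m \<Longrightarrow> x \<in> cyl w \<Longrightarrow> y \<in> cyl w \<Longrightarrow> dist x y < e"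
proof -
  \<comment> \<open>One constant dominates both b and the diameter; the summand 1 makes it safe to
    divide by.\<close>
  let ?b = "b + diameter E + 1"
  have b: "?b > 0" "b \<le> ?b" "diameter E \<le> ?b" using assms diameter_E_nonneg by auto
  obtain m where m: "\<And>w. w \<in> words \<Longrightarrow> length w = m \<Longrightarrow> ratio w < e / ?b"
    using long_words_small[of "e / ?b"] assms b by auto
  have *: "ratio w * t < e" if "w \<in> words" "length w = m" "t \<le> ?b" for w t
  proof -
    have "ratio w * t \<le> ratio w * ?b" using that ratio_pos[of w] by simp
    also have "\<dots> < e" using m[OF that(1,2)] b by (simp add: pos_less_divide_eq)
    finally show ?thesis .
  qed
  show thesis
  proof (rule that[of m])
    fix w assume w: "w \<in> words" "length w = m"
    show "ratio w * b < e" using *[OF w b(2)] .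
    fix x y assume "x \<in> cyl w" "y \<in> cyl w"
    then show "dist x y < e" using diam_cyl[OF w(1)] *[OF w b(3)] by (meson le_less_trans)
  qed
qed

section \<open>Separation of cylinders\<close>

lemma c_props: "0 < c"
  "\<And>i j x y. i \<in> letters \<Longrightarrow> j \<in> letters \<Longrightarrow> i \<noteq> j \<Longrightarrow> x \<in> E \<Longrightarrow> y \<in> E \<Longrightarrow> c \<le> dist (f i x) (f j y)"
proof -
  let ?P = "{(i, j). i \<in> letters \<and> j \<in> letters \<and> i \<noteq> j}"
  let ?D = "{setdist (f i ` E) (f j ` E) | i j. i \<in> letters \<and> j \<in> letters \<and> i \<noteq> j}"
  have D: "?D = (\<lambda>(i, j). setdist (f i ` E) (f j ` E)) ` ?P" by auto
  have "finite ?P" by (rule finite_subset[of _ "letters \<times> letters"]) (auto simp: finite_letters)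
  then have fin: "finite ?D" unfolding D by blast
  have "(1, 2) \<in> ?P" using N_ge_2 by (auto simp: letters_def)
  then have "?D \<noteq> {}" unfolding D by blast
  then have "c \<in> ?D" unfolding separation_const_def letters_def[symmetric] using Min_in[OF fin] by blast
  then obtain i j where ij: "i \<in> letters" "j \<in> letters" "i \<noteq> j" "c = setdist (f i ` E) (f j ` E)"
    by blast
  have cc: "compact (f i ` E)" if "i \<in> letters" for i
    using compact_cyl[of "[i]"] that by (simp add: cyl_Cons)
  show "0 < c" unfolding ij(4) using ij cc separated E_nonempty
    by (subst setdist_gt_0_compact_closed) (auto simp: strong_separation_def letters_def compact_imp_closed)
  fix i j x y assume A: "i \<in> letters" "j \<in> letters" "i \<noteq> j" "x \<in> E" "y \<in> E"
  have "c \<le> setdist (f i ` E) (f j ` E)"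
    unfolding separation_const_def letters_def[symmetric] using fin A by (intro Min_le) blast+
  also have "\<dots> \<le> dist (f i x) (f j y)" using A by (intro setdist_le_dist) auto
  finally show "c \<le> dist (f i x) (f j y)" .
qed

lemmas c_pos = c_props(1) and c_le_dist = c_props(2)

text \<open>Each common initial letter scales the distance by its ratio. At the first letter where
  the words differ the distance is already at least c, and the ratio of the remaining word is at
  most 1.\<close>

lemma cyl_gap:
  assumes "w \<in> words" "w' \<in> words" "length w = length w'" "w \<noteq> w'"
    "x \<in> cyl w" "y \<in> cyl w'"
  shows "c * ratio w \<le> dist x y"
  using assms
proof (induction w arbitrary: w' x y)
  case (Cons i w)
  obtain j v where w': "w' = j # v" using Cons.prems by (cases w') auto
  obtain x1 y1 where xy: "x = f i x1" "y = f j y1" "x1 \<in> cyl w" "y1 \<in> cyl v"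
    using Cons.prems unfolding w' cyl_Cons by auto
  have ij: "i \<in> letters" "j \<in> letters" "w \<in> words" "v \<in> words"
    using Cons.prems w' by auto
  show ?case
  proof (cases "i = j")
    case True
    have "c * ratio w \<le> dist x1 y1" using Cons w' True xy ij by (intro Cons.IH) auto
    then have "r i * (c * ratio w) \<le> r i * dist x1 y1" using r_pos[OF ij(1)] by simp
    then show ?thesis using True xy ij by (simp add: dist_f mult_ac)
  next
    case False
    have "c * ratio (i # w) \<le> c" using ratio_le_1[OF Cons.prems(1)] c_pos by (simp add: mult_left_le)
    also have "c \<le> dist x y" unfolding xy using False ij xy cyl_subset_E by (intro c_le_dist) auto
    finally show ?thesis .
  qed
qed simp

lemma cyl_disjoint:
  assumes "w \<in> words" "w' \<in> words" "length w = length w'" "w \<noteq> w'"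
  shows "cyl w \<inter> cyl w' = {}"
proof (rule ccontr)
  assume "cyl w \<inter> cyl w' \<noteq> {}"
  then obtain x where "x \<in> cyl w" "x \<in> cyl w'" by blast
  from cyl_gap[OF assms this] show False using c_pos ratio_pos[OF assms(1)] by (simp add: mult_le_0_iff)
qed

text \<open>y lies in some cylinder of the same length as w, and every other such cylinder is at
  least \<open>c * ratio w\<close> away from x.\<close>

lemma mem_cyl_if_close:
  assumes "w \<in> words" "x \<in> cyl w" "y \<in> E" "dist x y < c * ratio w"
  shows "y \<in> cyl w"
proof -
  obtain v where v: "v \<in> words" "length v = length w" "y \<in> cyl v"
    using assms(3) by (rule E_Union_cyl)
  have "v = w"
  proof (rule ccontr)
    assume "v \<noteq> w"
    then show False using cyl_gap[of w v x y] assms v by (metis not_le)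
  qed
  then show ?thesis using v by simp
qed

lemma cball_Int_E_subset_cyl:
  assumes "w \<in> words" "y \<in> E" "d < c"
  shows "cball (word_map w y) (ratio w * d) \<inter> E \<subseteq> cyl w"
proof
  fix z assume z: "z \<in> cball (word_map w y) (ratio w * d) \<inter> E"
  then have "dist (word_map w y) z \<le> ratio w * d" by simp
  also have "\<dots> < ratio w * c" using assms ratio_pos[of w] by simp
  also have "\<dots> = c * ratio w" by (rule mult.commute)
  finally show "z \<in> cyl w"
    using assms z by (rule_tac mem_cyl_if_close[of w "word_map w y"]) (simp_all add: cyl_def)
qed

text \<open>A similitude is affine: after subtracting its value at 0 it scales distances and fixes
  0, hence is linear, and injective linear maps in finite dimension are onto. Surjectivity provides
  the centre of a pulled-back sphere.\<close>

lemma surj_word_map: "w \<in> words \<Longrightarrow> surj (word_map w)"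
proof -
  assume w: "w \<in> words"
  define g where "g x = word_map w x - word_map w 0" for x
  have "linear g" by (rule scaling_linear[where c="ratio w"])
    (use dist_word_map[OF w] in \<open>auto simp: g_def dist_norm\<close>)
  moreover have "inj g" using inj_word_map[OF w] by (auto simp: g_def inj_def)
  ultimately have "surj g" by (rule linear_inj_imp_surj)
  have "\<exists>x. y = word_map w x" for y
    using surjD[OF \<open>surj g\<close>, of "y - word_map w 0"] by (auto simp: g_def)
  then show ?thesis by (auto simp: surj_def)
qed

lemma vimage_cball:
  assumes "w \<in> words"
  shows "word_map w -` cball (word_map w x) (ratio w * d) = cball x d"
  using ratio_pos[OF assms] by (auto simp: dist_word_map[OF assms])

lemma vimage_sphere:
  assumes "w \<in> words"
  obtains p' where "word_map w -` sphere p R = sphere p' (R / ratio w)"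
proof -
  obtain p' where "p = word_map w p'" using surj_word_map[OF assms] by (metis surjD)
  then show thesis using ratio_pos[OF assms]
    by (intro that[of p']) (auto simp: dist_word_map[OF assms] field_simps)
qed


section \<open>Cylinders determine measures concentrated on E\<close>

lemma cyl_Int_cyl:
  assumes "w \<in> words" "v \<in> words" "length w \<le> length v"
  shows "cyl w \<inter> cyl v = {} \<or> cyl w \<inter> cyl v = cyl v"
proof -
  define v1 v2 where "v1 = take (length w) v" "v2 = drop (length w) v"
  then have v: "v = v1 @ v2" "length w = length v1" using assms(3) by auto
  then have sub: "cyl v \<subseteq> cyl v1" using cyl_append_subset[of v2 v1] assms(2) by simp
  show ?thesis
  proof (cases "w = v1")
    case False
    then have "cyl w \<inter> cyl v1 = {}" using assms v by (intro cyl_disjoint) auto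
    then show ?thesis using sub by blast
  qed (use sub in auto)
qed

lemma finite_words_length: "finite {w \<in> words. length w = m}"
  using finite_lists_length_eq[OF finite_letters, of m]
  by (rule rev_finite_subset) (auto simp: words_def)

lemma countable_words: "countable words"
  by (rule countableI_type)

lemma cyl_nbhd:
  assumes "x \<in> E" "0 < e"
  obtains w where "w \<in> words" "x \<in> cyl w" "\<And>y. y \<in> cyl w \<Longrightarrow> dist x y < e"
proof -
  obtain m where m: "\<And>w x y. w \<in> words \<Longrightarrow> length w = m \<Longrightarrow> x \<in> cyl w \<Longrightarrow> y \<in> cyl w \<Longrightarrow> dist x y < e"
    by (rule long_cyl_small[OF assms(2), of 0]) blast+
  obtain w where "w \<in> words" "length w = m" "x \<in> cyl w"
    using assms(1) by (rule E_Union_cyl)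
  then show thesis using m that by blast
qed

lemma closed_cyl: "w \<in> words \<Longrightarrow> closed (cyl w)"
  by (intro compact_imp_closed compact_cyl)

lemma borel_cyl [measurable]: "w \<in> words \<Longrightarrow> cyl w \<in> sets borel"
  by (intro borel_closed closed_cyl)

lemma borel_E [measurable]: "E \<in> sets borel"
  using borel_cyl[of "[]"] by simp

lemma borel_measurable_f: "i \<in> letters \<Longrightarrow> f i \<in> borel_measurable borel"
  using continuous_on_word_map[of "[i]" UNIV] by (intro borel_measurable_continuous_onI) simp

text \<open>Uniqueness on an intersection-stable generator. The generator \<open>G\<close> is stated
  through traces on E, so that it also contains the Borel sets off E and generates the whole Borel
  algebra; since the complement of E is null, the measure of a set depends only on its
  trace.\<close>

lemma measure_eqI_cyl:
  fixes M M' :: "'a measure"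
  assumes sets: "sets M = sets borel" "sets M' = sets borel"
    and null: "emeasure M (- E) = 0" "emeasure M' (- E) = 0"
    and fin: "emeasure M E \<noteq> \<infinity>"
    and eq: "\<And>w. w \<in> words \<Longrightarrow> emeasure M (cyl w) = emeasure M' (cyl w)"
  shows "M = M'"
proof -
  define G where "G = {A \<in> sets borel. A \<inter> E = {} \<or> (\<exists>w\<in>words. A \<inter> E = cyl w)}"
  have restrict: "emeasure K X = emeasure K (X \<inter> E)"
    if "sets K = sets borel" "emeasure K (- E) = 0" "X \<in> sets borel" for K :: "'a measure" and X
  proof -
    have m: "X - E \<in> sets K" "X \<inter> E \<in> sets K" "- E \<in> sets K" using that by auto
    have "emeasure K (X - E) \<le> emeasure K (- E)" using m by (intro emeasure_mono) auto
    then have "X - E \<in> null_sets K" using that m by (intro null_setsI) auto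
    then have "emeasure K (X \<inter> E \<union> (X - E)) = emeasure K (X \<inter> E)"
      using m by (intro emeasure_Un_null_set)
    moreover have "X \<inter> E \<union> (X - E) = X" by blast
    ultimately show ?thesis by simp
  qed
  have cylG: "cyl w \<in> G" if "w \<in> words" for w
    using that cyl_subset_E[OF that] by (auto simp: G_def)
  have "UNIV \<in> G" by (auto simp: G_def intro!: bexI[of _ "[]"])
  have "Int_stable G"
  proof (rule Int_stableI)
    fix A B assume AB: "A \<in> G" "B \<in> G"
    have "A \<inter> B \<inter> E = (A \<inter> E) \<inter> (B \<inter> E)" by blast
    moreover have "cyl w \<inter> cyl v = {} \<or> (\<exists>u\<in>words. cyl w \<inter> cyl v = cyl u)"
      if "w \<in> words" "v \<in> words" for w v
      using cyl_Int_cyl[of w v] cyl_Int_cyl[of v w] that by (metis Int_commute linear)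
    moreover have "A \<inter> E = {} \<or> (\<exists>w\<in>words. A \<inter> E = cyl w)" "B \<inter> E = {} \<or> (\<exists>w\<in>words. B \<inter> E = cyl w)"
      using AB by (simp_all add: G_def)
    ultimately have "A \<inter> B \<inter> E = {} \<or> (\<exists>u\<in>words. A \<inter> B \<inter> E = cyl u)"
      by (elim disjE bexE) simp_all
    moreover have "A \<inter> B \<in> sets borel" using AB by (intro sets.Int) (simp_all add: G_def)
    ultimately show "A \<inter> B \<in> G" by (simp add: G_def)
  qed
  have "O' \<in> sigma_sets UNIV G" if "open O'" for O'
  proof -
    \<comment> \<open>Every point of E has arbitrarily small cylinders around it, so the part of an
      open set inside E is a union of cylinders, and there are only countably many words.\<close>
    have O': "O' = (O' - E) \<union> (\<Union>w\<in>{w \<in> words. cyl w \<subseteq> O'}. cyl w)" (is "_ = ?R")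
    proof
      show "O' \<subseteq> ?R"
      proof
        fix x assume x: "x \<in> O'"
        show "x \<in> ?R"
        proof (cases "x \<in> E")
          case True
          obtain e where e: "e > 0" "ball x e \<subseteq> O'" using \<open>open O'\<close> x by (meson openE)
          obtain w where w: "w \<in> words" "x \<in> cyl w" "\<And>y. y \<in> cyl w \<Longrightarrow> dist x y < e"
            using cyl_nbhd[OF True e(1)] by blast
          then have "cyl w \<subseteq> O'" using e by (auto simp: subset_iff)
          then show ?thesis using w by blast
        qed (use x in blast)
      qed
    qed blast
    have "countable {w \<in> words. cyl w \<subseteq> O'}"
      by (rule countable_subset[OF _ countable_words]) blast
    then have "(\<Union>w\<in>{w \<in> words. cyl w \<subseteq> O'}. cyl w) \<in> sigma_sets UNIV G"
      by (intro sigma_sets_UNION) (auto intro: sigma_sets.Basic cylG)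
    moreover have "O' - E \<in> G" using \<open>open O'\<close> by (auto simp: G_def)
    then have "O' - E \<in> sigma_sets UNIV G" by (rule sigma_sets.Basic)
    ultimately show ?thesis by (subst O') (intro sigma_sets_Un)
  qed
  then have "sigma_sets UNIV {S. open S} \<subseteq> sigma_sets UNIV G"
    by (intro sigma_sets_mono) auto
  moreover have "sigma_sets UNIV G \<subseteq> sets borel"
    using sets.sigma_sets_subset[of G "borel :: 'a measure"] by (auto simp: G_def)
  moreover have "sets (borel :: 'a measure) = sigma_sets UNIV {S. open S}"
    by (simp add: borel_def)
  ultimately have G: "sets borel = sigma_sets UNIV G" by simp
  show ?thesis
  proof (rule measure_eqI_generator_eq[where \<Omega>=UNIV and A="\<lambda>_::nat. UNIV"])
    fix X assume "X \<in> G"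
    then have "X \<in> sets borel" "X \<inter> E = {} \<or> (\<exists>w\<in>words. X \<inter> E = cyl w)" by (auto simp: G_def)
    then have "emeasure M (X \<inter> E) = emeasure M' (X \<inter> E)" using eq by auto
    then show "emeasure M X = emeasure M' X"
      using restrict[OF sets(1) null(1) \<open>X \<in> sets borel\<close>] restrict[OF sets(2) null(2) \<open>X \<in> sets borel\<close>]
      by simp
  next
    show "emeasure M UNIV \<noteq> \<infinity>"
      using restrict[OF sets(1) null(1), of UNIV] fin by simp
  qed (use \<open>Int_stable G\<close> \<open>UNIV \<in> G\<close> sets G in auto)
qed

end

section \<open>The natural measure\<close>

locale natural_ifs = separated_ifs N f r E
  for N :: nat and f :: "nat \<Rightarrow> 'a::euclidean_space \<Rightarrow> 'a" and r E +
  fixes s :: real and \<mu> :: "'a measure"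
  assumes natural: "natural_measure N f r s E \<mu>"
begin

lemma prob_space_mu: "prob_space \<mu>" and sets_mu [measurable_cong, simp]: "sets \<mu> = sets borel"
  and emeasure_E: "emeasure \<mu> E = 1"
  and emeasure_cyl: "w \<in> words \<Longrightarrow> emeasure \<mu> (cyl w) = ennreal (ratio w powr s)"
  using natural
  by (auto simp: natural_measure_def cyl_def words_def letters_def ratio_def word_map_def)

sublocale prob_space \<mu>
  by (rule prob_space_mu)

lemma space_mu [simp]: "space \<mu> = UNIV"
  using sets_eq_imp_space_eq[OF sets_mu] by simp

lemma prob_cyl: "w \<in> words \<Longrightarrow> prob (cyl w) = ratio w powr s"
  by (simp add: measure_def emeasure_cyl)

lemma prob_cyl_pos: "w \<in> words \<Longrightarrow> 0 < prob (cyl w)"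
  using ratio_pos by (fastforce simp: prob_cyl)

lemma prob_E: "prob E = 1"
  by (simp add: measure_def emeasure_E)

lemma emeasure_compl_E: "emeasure \<mu> (- E) = 0"
  using prob_compl[of E] prob_E by (simp add: emeasure_eq_measure Compl_eq_Diff_UNIV)

text \<open>As functions of A both sides are measures that vanish off E, so comparing them on
  cylinders suffices. There the claim is the multiplicativity of \<open>ratio\<close> when the word
  starts with i, and 0 = 0 when it starts with another letter.\<close>

lemma emeasure_Int_f:
  assumes i: "i \<in> letters" and A: "A \<in> sets borel"
  shows "emeasure \<mu> (f i ` E \<inter> A) = ennreal (r i powr s) * emeasure \<mu> (f i -` A)"
proof -
  note [measurable] = borel_measurable_f[OF i]
  define M1 where "M1 = scale_measure (ennreal (r i powr s)) (distr \<mu> borel (f i))"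
  define M2 where "M2 = density \<mu> (indicator (f i ` E))"
  have fE [measurable]: "f i ` E \<in> sets borel" using borel_cyl[of "[i]"] i by (simp add: cyl_Cons)
  have M1: "emeasure M1 B = ennreal (r i powr s) * emeasure \<mu> (f i -` B)" if "B \<in> sets borel" for B
    using that by (simp add: M1_def emeasure_distr)
  have M2: "emeasure M2 B = emeasure \<mu> (f i ` E \<inter> B)" if "B \<in> sets borel" for B
    using that fE unfolding M2_def by (intro emeasure_restricted) auto
  have vim: "f i -` B \<in> sets borel" if "B \<in> sets borel" for B
    using measurable_sets[OF borel_measurable_f[OF i] that] by simp
  have "M1 = M2"
  proof (rule measure_eqI_cyl)
    show "sets M1 = sets borel" "sets M2 = sets borel" by (simp_all add: M1_def M2_def)
    have "f i -` (- E) \<subseteq> - E" using f_in_E[OF i] by auto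
    then have "emeasure \<mu> (f i -` (- E)) \<le> emeasure \<mu> (- E)" by (intro emeasure_mono) auto
    then show "emeasure M1 (- E) = 0" by (simp add: M1 emeasure_compl_E)
    have "f i ` E \<inter> - E = {}" using f_in_E[OF i] by auto
    then show "emeasure M2 (- E) = 0" by (simp add: M2)
    show "emeasure M1 E \<noteq> \<infinity>" by (simp add: M1 ennreal_mult_eq_top_iff)
    fix v assume v: "v \<in> words"
    have "ennreal (r i powr s) * emeasure \<mu> (f i -` cyl v) = emeasure \<mu> (f i ` E \<inter> cyl v)"
    proof (cases v)
      case Nil
      have "f i ` E \<inter> E = cyl [i]" using f_in_E[OF i] by (auto simp: cyl_Cons)
      \<comment> \<open>The preimage of E may be larger than E, but it contains E and therefore has
        full measure.\<close>
      moreover have "emeasure \<mu> E \<le> emeasure \<mu> (f i -` E)"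
        using f_in_E[OF i] vim by (intro emeasure_mono) auto
      then have "emeasure \<mu> (f i -` E) = 1"
        using emeasure_E emeasure_le_1[of "f i -` E"] by simp
      ultimately show ?thesis using i Nil by (simp add: emeasure_cyl)
    next
      case (Cons j v')
      then have jv: "j \<in> letters" "v' \<in> words" using v by auto
      show ?thesis
      proof (cases "i = j")
        case True
        have "f i ` E \<inter> cyl v = cyl v"
          using cyl_subset_E[OF jv(2)] True by (auto simp: Cons cyl_Cons)
        moreover have "f i -` cyl v = cyl v'"
          using True inj_f[OF i] by (simp add: Cons cyl_Cons inj_vimage_image_eq)
        ultimately show ?thesis using v jv i r_pos[OF i] ratio_pos[OF jv(2)] True
          by (simp add: emeasure_cyl Cons powr_mult ennreal_mult)
      next
        case False
        have d: "f i ` E \<inter> f j ` E = {}"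
          using False i jv separated by (auto simp: strong_separation_def letters_def)
        then have "f i ` E \<inter> cyl v = {}" using cyl_subset_E[OF jv(2)] by (auto simp: Cons cyl_Cons)
        \<comment> \<open>The preimage need not be empty; it only has to avoid E, whose complement
          is null.\<close>
        moreover have "f i -` cyl v \<subseteq> - E"
          using d cyl_subset_E[OF jv(2)] by (auto simp: Cons cyl_Cons)
        then have "emeasure \<mu> (f i -` cyl v) \<le> emeasure \<mu> (- E)" by (intro emeasure_mono) auto
        ultimately show ?thesis by (simp add: emeasure_compl_E)
      qed
    qed
    then show "emeasure M1 (cyl v) = emeasure M2 (cyl v)" using v by (simp add: M1 M2)
  qed
  then show ?thesis using A M1 M2 by metis
qed

lemma prob_Int_f:
  assumes "i \<in> letters" "A \<in> sets borel"
  shows "prob (f i ` E \<inter> A) = r i powr s * prob (f i -` A)"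
  using emeasure_Int_f[OF assms] by (simp add: measure_def enn2real_mult)

lemma prob_Int_cyl:
  assumes "w \<in> words" "A \<in> sets borel"
  shows "prob (cyl w \<inter> A) = ratio w powr s * prob (word_map w -` A)"
  using assms
proof (induction w arbitrary: A rule: words_induct)
  case Nil
  have "prob (E \<inter> A) = prob A"
    using emeasure_compl_E Nil
    by (intro finite_measure_eq_AE) (auto intro!: AE_I[of _ _ "- E"])
  then show ?case by simp
next
  case (Cons i w)
  have v: "f i -` A \<in> sets borel" 
    using measurable_sets[OF borel_measurable_f[OF Cons.hyps(1)] Cons.prems] by simp
  have b: "cyl (i # w) \<in> sets borel" using Cons by simp
  \<comment> \<open>Keeping the cylinder inside the set makes its preimage under \<open>f i\<close>
    the set to which the induction hypothesis applies.\<close>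
  have "cyl (i # w) \<inter> A = f i ` E \<inter> (cyl (i # w) \<inter> A)"
    using cyl_subset_E[OF Cons.hyps(2)] by (auto simp: cyl_Cons)
  then have "prob (cyl (i # w) \<inter> A) = r i powr s * prob (f i -` (cyl (i # w) \<inter> A))"
    using prob_Int_f[OF Cons.hyps(1), of "cyl (i # w) \<inter> A"] b Cons.prems by simp
  also have "f i -` (cyl (i # w) \<inter> A) = cyl w \<inter> f i -` A"
    using inj_f[OF Cons.hyps(1)] by (auto simp: cyl_Cons inj_def)
  also have "prob \<dots> = ratio w powr s * prob (word_map w -` (f i -` A))"
    using v by (rule Cons.IH)
  finally show ?case using r_pos[OF Cons.hyps(1)] ratio_pos[OF Cons.hyps(2)]
    by (simp add: powr_mult vimage_comp comp_def)
qed

lemma prob_Int_E: "A \<in> sets borel \<Longrightarrow> prob (E \<inter> A) = prob A"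
  using prob_Int_cyl[of "[]" A] by simp

lemma prob_cball_pos:
  assumes "x \<in> E" "0 < d"
  shows "0 < prob (cball x d)"
proof -
  obtain w where w: "w \<in> words" "x \<in> cyl w" "\<And>y. y \<in> cyl w \<Longrightarrow> dist x y < d"
    using cyl_nbhd[OF assms] by blast
  have "prob (cyl w) \<le> prob (cball x d)" using w by (intro finite_measure_mono) (auto simp: less_imp_le)
  then show ?thesis using prob_cyl_pos[OF w(1)] by simp
qed

lemma prob_cball_word_map:
  assumes "w \<in> words" "cball (word_map w x) (ratio w * d) \<inter> E \<subseteq> cyl w"
  shows "prob (cball (word_map w x) (ratio w * d)) = ratio w powr s * prob (cball x d)"
proof -
  let ?B = "cball (word_map w x) (ratio w * d)"
  have "prob ?B = prob (E \<inter> ?B)" by (simp add: prob_Int_E)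
  also have "E \<inter> ?B = cyl w \<inter> ?B" using assms cyl_subset_E[of w] by blast
  also have "prob \<dots> = ratio w powr s * prob (word_map w -` ?B)"
    using assms(1) by (intro prob_Int_cyl) auto
  finally show ?thesis by (simp add: vimage_cball[OF assms(1)])
qed

lemma prob_cball_f_le:
  assumes "i \<in> letters"
  shows "r i powr s * prob (cball x d) \<le> prob (cball (f i x) (r i * d))"
  using prob_Int_cyl[of "[i]" "cball (f i x) (r i * d)"] vimage_cball[of "[i]" x d] assms
    finite_measure_mono[of "cyl [i] \<inter> cball (f i x) (r i * d)" "cball (f i x) (r i * d)"]
  by simp

lemma inv_density_f_le:
  assumes "i \<in> letters" "x \<in> E" "0 < d"
  shows "inv_density \<mu> s (f i x) (r i * d) \<le> inv_density \<mu> s x d"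
proof -
  have r: "0 < r i" "0 < r i powr s" using r_pos[OF assms(1)] by auto
  have "inv_density \<mu> s (f i x) (r i * d) = r i powr s * (2 * d) powr s / prob (cball (f i x) (r i * d))"
    using r assms by (simp add: inv_density_def powr_mult[symmetric] mult_ac)
  also have "\<dots> \<le> r i powr s * (2 * d) powr s / (r i powr s * prob (cball x d))"
    using prob_cball_f_le[OF assms(1), of x d] prob_cball_pos[OF assms(2,3)] r
    by (intro frac_le) auto
  also have "\<dots> = inv_density \<mu> s x d" using r by (simp add: inv_density_def)
  finally show ?thesis .
qed

lemma inv_density_word_map:
  assumes "w \<in> words" "cball (word_map w x) (ratio w * d) \<inter> E \<subseteq> cyl w" "0 < d"
  shows "inv_density \<mu> s (word_map w x) (ratio w * d) = inv_density \<mu> s x d"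
proof -
  have "(2 * (ratio w * d)) powr s = ratio w powr s * (2 * d) powr s"
    using ratio_pos[OF assms(1)] assms(3) by (simp add: powr_mult[symmetric] mult_ac)
  moreover have "ratio w powr s > 0" using ratio_pos[OF assms(1)] by simp
  ultimately show ?thesis by (simp add: inv_density_def prob_cball_word_map[OF assms(1,2)])
qed

end

section \<open>Spheres are null\<close>

context separated_ifs
begin

text \<open>Let z be the fixed point of \<open>f 1\<close> and y another point of E. The orbit of y
  is z plus \<open>q ^ k *\<^sub>R W k\<close>, where \<open>W k\<close> is the k-th image of y - z
  under a linear isometry. If the orbit lay on a sphere through z, the component of
  \<open>W k\<close> towards the centre would decay like \<open>q ^ k\<close>; but orbits of an
  isometry on a bounded set return close to their start.\<close>

lemma not_subset_sphere: "\<not> E \<subseteq> sphere p R"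
proof
  assume sub: "E \<subseteq> sphere p R"
  define g where "g = f 1"
  define q where "q = r 1"
  have 1: "1 \<in> letters" "2 \<in> letters" using N_ge_2 by (auto simp: letters_def)
  have q: "0 < q" "q < 1" and dist_g: "\<And>x y. dist (g x) (g y) = q * dist x y"
    and g_in: "\<And>x. x \<in> E \<Longrightarrow> g x \<in> E"
    using r_pos[OF 1(1)] r_less_1[OF 1(1)] dist_f[OF 1(1)] f_in_E[OF 1(1)] by (auto simp: g_def q_def)
  have "\<exists>!x\<in>E. g x = x"
    by (rule Banach_fix[of _ q])
       (use q dist_g g_in E_nonempty compact_imp_complete[OF compact_E] in auto)
  then obtain z where z: "z \<in> E" "g z = z" by blast
  obtain x where x: "x \<in> E" using E_nonempty by blast
  \<comment> \<open>Two separated images of one point show that E has a point other than z.\<close>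
  have "f 1 x \<noteq> f 2 x" using c_le_dist[OF 1 _ x x] c_pos by force
  then obtain y where y: "y \<in> E" "y \<noteq> z" using f_in_E[OF 1(1) x] f_in_E[OF 1(2) x] by metis
  define v where "v = y - z"
  define u where "u = p - z"
  \<comment> \<open>The linear part of g at its fixed point z, normalised to ratio 1.\<close>
  define L where "L x = (1 / q) *\<^sub>R (g (z + x) - z)" for x
  have "dist (L a) (L b) = dist a b" for a b
  proof -
    have "L a - L b = (1 / q) *\<^sub>R (g (z + a) - g (z + b))" by (simp add: L_def algebra_simps)
    then have "dist (L a) (L b) = (1 / q) * dist (g (z + a)) (g (z + b))" using q by (simp add: dist_norm)
    then show ?thesis using q by (simp add: dist_g)
  qed
  moreover have "L 0 = 0" using z by (simp add: L_def)
  ultimately have dist_L: "\<And>a b. dist (L a) (L b) = dist a b" and lin: "linear L"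
    by (auto intro: isometry_linear)
  define W where "W k = (L ^^ k) v" for k
  have dist_W: "dist (W (k + a)) (W (k + b)) = dist (W a) (W b)" for k a b
    by (induction k) (simp_all add: W_def dist_L)
  have norm_W: "norm (W k) = norm v" for k
  proof (induction k)
    case (Suc k)
    then show ?case using dist_L[of "W k" 0] \<open>L 0 = 0\<close> by (simp add: W_def)
  qed (simp add: W_def)
  have g_pow: "(g ^^ k) y = z + q ^ k *\<^sub>R W k" for k
  proof (induction k)
    case (Suc k)
    have "g (z + a) = z + q *\<^sub>R L a" for a using q by (simp add: L_def)
    then have "(g ^^ Suc k) y = z + q *\<^sub>R L (q ^ k *\<^sub>R W k)" using Suc by simp
    then show ?case by (simp add: linear_scale[OF lin] W_def)
  qed (simp add: W_def v_def)
  have on_sphere: "(norm (a - z))\<^sup>2 = 2 * (u \<bullet> (a - z))" if "a \<in> E" for a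
  proof -
    have "a \<in> sphere p R" "z \<in> sphere p R" using sub that z by blast+
    then have "norm (p - a) = norm (p - z)" by (simp add: dist_norm)
    then have "(norm (u - (a - z)))\<^sup>2 = (norm u)\<^sup>2" by (simp add: u_def)
    then show ?thesis by (simp add: power2_norm_eq_inner inner_diff inner_commute)
  qed
  have uW: "u \<bullet> W k = q ^ k * (norm v)\<^sup>2 / 2" for k
  proof -
    have "(g ^^ k) y \<in> E" by (induction k) (use y g_in in auto)
    from on_sphere[OF this] have "(q ^ k * norm v)\<^sup>2 = 2 * (q ^ k * (u \<bullet> W k))"
      using q by (simp add: g_pow norm_W)
    then have "q ^ k * (q ^ k * (norm v)\<^sup>2) = q ^ k * (2 * (u \<bullet> W k))"
      by (simp add: power2_eq_square mult_ac)
    then show ?thesis using q by simp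
  qed
  \<comment> \<open>Chosen so that \<open>(norm u + 1) * e\<close> is half of
    \<open>(1 - q) * (norm v)\<^sup>2 / 2\<close>, the smallest drop from
    \<open>u \<bullet> W 0\<close> to \<open>u \<bullet> W b\<close> that b \<ge> 1 permits. The 1
    covers the case u = 0.\<close>
  define e where "e = (1 - q) * (norm v)\<^sup>2 / (4 * (norm u + 1))"
  have nv: "norm v > 0" using y by (simp add: v_def)
  have nu: "norm u + 1 > 0" by (simp add: add_nonneg_pos)
  have "e > 0" using q nv nu by (simp add: e_def)
  \<comment> \<open>Recurrence: two late terms of a convergent subsequence are close, and
    \<open>dist_W\<close> cancels the common power of L, leaving \<open>W b\<close> close to
    \<open>W 0\<close>.\<close>
  have "\<forall>k. W k \<in> cball 0 (norm v)" by (simp add: norm_W)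
  then obtain l \<sigma> where \<sigma>: "strict_mono \<sigma>" "(W \<circ> \<sigma>) \<longlonglongrightarrow> l"
    using compact_cball[of "0::'a" "norm v"] unfolding compact_def by blast
  then have "Cauchy (W \<circ> \<sigma>)" by (intro LIMSEQ_imp_Cauchy)
  then obtain n where n: "\<And>a b. a \<ge> n \<Longrightarrow> b \<ge> n \<Longrightarrow> dist ((W \<circ> \<sigma>) a) ((W \<circ> \<sigma>) b) < e"
    using \<open>e > 0\<close> unfolding Cauchy_def by blast
  define b where "b = \<sigma> (Suc n) - \<sigma> n"
  have b: "\<sigma> (Suc n) = \<sigma> n + b" "b \<ge> 1"
    using strict_monoD[OF \<sigma>(1), of n "Suc n"] by (auto simp: b_def)
  have "dist (W b) (W 0) < e"
    using n[of "Suc n" n] dist_W[of "\<sigma> n" b 0] b by simp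
  then have close: "norm (W 0 - W b) < e" by (simp add: dist_norm norm_minus_commute)
  have "u \<bullet> W 0 - u \<bullet> W b \<le> norm u * norm (W 0 - W b)"
    unfolding inner_diff_right[symmetric] by (rule norm_cauchy_schwarz)
  also have "\<dots> \<le> (norm u + 1) * e" using close nu \<open>e > 0\<close> by (intro mult_mono) auto
  also have "\<dots> = (1 - q) * (norm v)\<^sup>2 / 4" 
  proof -
    have "(norm u + 1) * (t / (4 * (norm u + 1))) = t / 4" for t using nu by (simp add: field_simps)
    then show ?thesis by (simp only: e_def)
  qed
  finally have "(1 - q ^ b) * (norm v)\<^sup>2 / 2 \<le> (1 - q) * (norm v)\<^sup>2 / 4"
    by (simp add: uW left_diff_distrib diff_divide_distrib)
  moreover have "q ^ b \<le> q" using b q power_decreasing[of 1 b q] by simp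
  then have "(1 - q) * (norm v)\<^sup>2 \<le> (1 - q ^ b) * (norm v)\<^sup>2" by (intro mult_right_mono) auto
  moreover have "(1 - q) * (norm v)\<^sup>2 > 0" using q nv by simp
  ultimately show False by linarith
qed

text \<open>K keeps a positive distance from the complement of G. Half of it is spent on the
  diameter of the cylinder, half on the radius of a ball centred in it.\<close>

lemma small_cyl_cover:
  assumes "compact K" "open G" "K \<subseteq> G" "0 \<le> b" "0 < e"
  obtains n where "\<And>w. w \<in> words \<Longrightarrow> length w = n \<Longrightarrow> ratio w * b < e"
    "\<And>w x. w \<in> words \<Longrightarrow> length w = n \<Longrightarrow> cyl w \<inter> K \<noteq> {} \<Longrightarrow> x \<in> cyl w \<Longrightarrow> cball x (ratio w * b) \<subseteq> G"
proof -
  obtain \<epsilon> where \<epsilon>: "\<epsilon> > 0" "(\<Union>x\<in>K. ball x \<epsilon>) \<subseteq> G"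
    using compact_subset_open_imp_ball_epsilon_subset[OF assms(1-3)] by blast
  have "min e (\<epsilon> / 2) > 0" using \<epsilon> assms by simp
  then obtain n where n: "\<And>w. w \<in> words \<Longrightarrow> length w = n \<Longrightarrow> ratio w * b < min e (\<epsilon> / 2)"
    "\<And>w x y. w \<in> words \<Longrightarrow> length w = n \<Longrightarrow> x \<in> cyl w \<Longrightarrow> y \<in> cyl w \<Longrightarrow> dist x y < min e (\<epsilon> / 2)"
    using long_cyl_small[OF _ assms(4)] by metis
  show thesis
  proof (rule that[of n])
    fix w assume w: "w \<in> words" "length w = n"
    show "ratio w * b < e" using n(1)[OF w] by simp
    fix x assume x: "cyl w \<inter> K \<noteq> {}" "x \<in> cyl w"
    then obtain p where p: "p \<in> cyl w" "p \<in> K" by blast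
    have "cball x (ratio w * b) \<subseteq> ball p \<epsilon>"
    proof
      fix y assume "y \<in> cball x (ratio w * b)"
      then have "dist x y < \<epsilon> / 2" using n(1)[OF w] by simp
      moreover have "dist p x < \<epsilon> / 2" using n(2)[OF w p(1) x(2)] by simp
      ultimately show "y \<in> ball p \<epsilon>" using dist_triangle[of p y x] by simp
    qed
    then show "cball x (ratio w * b) \<subseteq> G" using \<epsilon> p by blast
  qed
qed

end

context natural_ifs
begin

lemma prob_Union_in_cyl:
  assumes "W \<subseteq> {w \<in> words. length w = n}" "\<And>w. w \<in> W \<Longrightarrow> A w \<in> sets borel"
    "\<And>w. w \<in> W \<Longrightarrow> A w \<subseteq> cyl w"
  shows "prob (\<Union>w\<in>W. A w) = (\<Sum>w\<in>W. prob (A w))"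
proof (rule finite_measure_finite_Union)
  show "finite W" using assms(1) finite_words_length by (rule finite_subset)
  show "disjoint_family_on A W" unfolding disjoint_family_on_def
  proof (intro ballI impI)
    fix w v assume wv: "w \<in> W" "v \<in> W" "w \<noteq> v"
    then have "cyl w \<inter> cyl v = {}" using assms(1) by (intro cyl_disjoint) auto
    then show "A w \<inter> A v = {}" using assms(3) wv by blast
  qed
qed (use assms in auto)

text \<open>Spheres are level sets of affine functionals of the lift \<open>x \<mapsto> (norm x ^ 2, x, 1)\<close>.
  Projecting the coefficient vector onto the span of the lift of \<open>E\<close> does not change the
  functional on \<open>E\<close>, and on the unit sphere of that span a limit of functionals with zero sets of
  measure tending to 1 would vanish on all of \<open>E\<close>.\<close>

lemma sphere_gap:
  obtains e where "0 < e" "\<And>p R. prob (sphere p R) \<le> 1 - e"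
proof (rule ccontr)
  assume "\<not> thesis"
  then have "\<exists>p R. prob (sphere p R) > 1 - 1 / real (Suc k)" for k
    using that[of "1 / real (Suc k)"] by (meson not_le of_nat_0_less_iff zero_less_Suc zero_less_divide_1_iff)
  then obtain P R where PR: "\<And>k. prob (sphere (P k) (R k)) > 1 - 1 / real (Suc k)" by metis
  define \<Phi> :: "'a \<Rightarrow> real \<times> 'a \<times> real" where "\<Phi> x = ((norm x)\<^sup>2, x, 1)" for x
  define T where "T = span (\<Phi> ` E)"
  define Z where "Z \<omega> = {x \<in> E. \<omega> \<bullet> \<Phi> x = 0}" for \<omega>
  have "\<exists>\<omega>\<in>T \<inter> sphere 0 1. E \<inter> sphere (P k) (R k) \<subseteq> Z \<omega>" for k
  proof -
    \<comment> \<open>The coefficients obtained by expanding the squared distance to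
      \<open>P k\<close> minus the squared radius.\<close>
    define \<omega>0 where "\<omega>0 = (1::real, - 2 *\<^sub>R P k, (norm (P k))\<^sup>2 - (R k)\<^sup>2)"
    have \<omega>0: "\<omega>0 \<bullet> \<Phi> x = (dist (P k) x)\<^sup>2 - (R k)\<^sup>2" for x
      by (simp add: \<omega>0_def \<Phi>_def dist_norm power2_norm_eq_inner inner_diff inner_commute)
    obtain a b where ab: "a \<in> T" "\<And>t. t \<in> T \<Longrightarrow> orthogonal b t" "\<omega>0 = a + b"
      using orthogonal_subspace_decomp_exists[of "\<Phi> ` E" \<omega>0] unfolding T_def by blast
    have a: "a \<bullet> \<Phi> x = (dist (P k) x)\<^sup>2 - (R k)\<^sup>2" if "x \<in> E" for x
    proof -
      have "b \<bullet> \<Phi> x = 0" using ab(2)[of "\<Phi> x"] that by (simp add: T_def span_base orthogonal_def)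
      then show ?thesis using \<omega>0[of x] by (simp add: ab(3) inner_add_left)
    qed
    have "a \<noteq> 0"
    proof
      assume "a = 0"
      \<comment> \<open>The radius \<open>R k\<close> may be negative, so only its absolute value
        can be recovered from the square.\<close>
      then have "(dist (P k) x)\<^sup>2 = \<bar>R k\<bar>\<^sup>2" if "x \<in> E" for x using a[OF that] by simp
      then have "dist (P k) x = \<bar>R k\<bar>" if "x \<in> E" for x using that by (metis abs_ge_zero power2_eq_imp_eq zero_le_dist)
      then have "E \<subseteq> sphere (P k) \<bar>R k\<bar>" by (simp add: subset_iff)
      then show False using not_subset_sphere by blast
    qed
    show ?thesis
    proof (rule bexI[of _ "(1 / norm a) *\<^sub>R a"])
      show "(1 / norm a) *\<^sub>R a \<in> T \<inter> sphere 0 1"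
        using ab(1) \<open>a \<noteq> 0\<close> by (simp add: T_def span_scale)
      show "E \<inter> sphere (P k) (R k) \<subseteq> Z ((1 / norm a) *\<^sub>R a)"
        using a by (auto simp: Z_def)
    qed
  qed
  then obtain \<omega> where \<omega>: "\<And>k. \<omega> k \<in> T \<inter> sphere 0 1"
    "\<And>k. E \<inter> sphere (P k) (R k) \<subseteq> Z (\<omega> k)" by metis
  have cont: "continuous_on UNIV (\<lambda>(\<omega>, x). \<omega> \<bullet> \<Phi> x)"
    unfolding \<Phi>_def case_prod_unfold by (intro continuous_intros)
  have Z_borel: "Z \<omega> \<in> sets borel" for \<omega>
  proof -
    have "continuous_on UNIV (\<lambda>x. \<omega> \<bullet> \<Phi> x)" unfolding \<Phi>_def by (intro continuous_intros)
    then have "closed {x. \<omega> \<bullet> \<Phi> x = 0}" by (intro closed_Collect_eq) auto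
    then have "E \<inter> {x. \<omega> \<bullet> \<Phi> x = 0} \<in> sets borel" by (intro sets.Int borel_E borel_closed)
    moreover have "E \<inter> {x. \<omega> \<bullet> \<Phi> x = 0} = Z \<omega>" by (auto simp: Z_def)
    ultimately show ?thesis by simp
  qed
  have "compact (T \<inter> sphere 0 1)"
    unfolding T_def by (intro closed_Int_compact closed_span compact_sphere)
  then obtain l \<sigma> where l: "l \<in> T \<inter> sphere 0 1" "strict_mono \<sigma>" "(\<omega> \<circ> \<sigma>) \<longlonglongrightarrow> l"
    using \<omega>(1) unfolding compact_def by meson
  have "\<exists>x\<in>E. l \<bullet> \<Phi> x \<noteq> 0"
  proof (rule ccontr)
    assume "\<not> ?thesis"
    then have "orthogonal l t" if "t \<in> \<Phi> ` E" for t using that by (auto simp: orthogonal_def)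
    moreover have "l \<in> span (\<Phi> ` E)" using l(1) by (simp add: T_def)
    ultimately have "orthogonal l l" by (metis orthogonal_to_span)
    then show False using l(1) by (auto simp: orthogonal_def)
  qed
  then obtain x where x: "x \<in> E" "l \<bullet> \<Phi> x \<noteq> 0" by blast
  \<comment> \<open>Nonvanishing is open jointly in functional and point. It therefore persists on
    one fixed cylinder around x for all functionals near l, and their zero sets miss a fixed
    positive mass.\<close>
  define V where "V = {t. (\<lambda>(\<omega>, x). \<omega> \<bullet> \<Phi> x) t \<noteq> 0}"
  have "open V" unfolding V_def using cont by (intro open_Collect_neq) auto
  moreover have "(l, x) \<in> V" using x by (simp add: V_def)
  ultimately obtain A B where AB: "open A" "open B" "(l, x) \<in> A \<times> B" "A \<times> B \<subseteq> V"
    by (rule open_prod_elim)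
  obtain e where e: "e > 0" "ball x e \<subseteq> B" using AB by (meson mem_Sigma_iff openE)
  obtain w where w: "w \<in> words" "x \<in> cyl w" "\<And>y. y \<in> cyl w \<Longrightarrow> dist x y < e"
    using cyl_nbhd[OF x(1) e(1)] by blast
  have "eventually (\<lambda>k. (\<omega> \<circ> \<sigma>) k \<in> A) sequentially"
    using topological_tendstoD[OF l(3) AB(1)] AB(3) by blast
  moreover have "eventually (\<lambda>k. 1 / real (Suc k) < prob (cyl w)) sequentially"
    using LIMSEQ_inverse_real_of_nat prob_cyl_pos[OF w(1)]
    by (intro order_tendstoD(2)) (auto simp: inverse_eq_divide)
  ultimately have "eventually (\<lambda>k. (\<omega> \<circ> \<sigma>) k \<in> A \<and> 1 / real (Suc k) < prob (cyl w)) sequentially"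
    by (rule eventually_conj)
  then obtain k where k: "\<omega> (\<sigma> k) \<in> A" "1 / real (Suc k) < prob (cyl w)"
    by (auto simp: eventually_sequentially)
  have "1 / real (Suc (\<sigma> k)) \<le> 1 / real (Suc k)"
    using seq_suble[OF l(2), of k] by (intro divide_left_mono) auto
  then have small: "1 / real (Suc (\<sigma> k)) < prob (cyl w)" using k by simp
  have "cyl w \<inter> Z (\<omega> (\<sigma> k)) = {}"
  proof -
    have "\<omega> (\<sigma> k) \<bullet> \<Phi> y \<noteq> 0" if "y \<in> cyl w" for y
    proof -
      have "y \<in> B" using w(3)[OF that] e by auto
      then have "(\<omega> (\<sigma> k), y) \<in> V" using AB(4) k(1) by blast
      then show ?thesis by (simp add: V_def)
    qed
    then show ?thesis by (auto simp: Z_def)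
  qed
  then have "prob (cyl w) + prob (Z (\<omega> (\<sigma> k))) = prob (cyl w \<union> Z (\<omega> (\<sigma> k)))"
    using w Z_borel by (intro finite_measure_Union[symmetric]) auto
  also have "\<dots> \<le> 1" by simp
  finally have "prob (Z (\<omega> (\<sigma> k))) \<le> 1 - prob (cyl w)" by simp
  moreover have "prob (sphere (P (\<sigma> k)) (R (\<sigma> k))) \<le> prob (Z (\<omega> (\<sigma> k)))"
  proof -
    have "prob (sphere (P (\<sigma> k)) (R (\<sigma> k))) = prob (E \<inter> sphere (P (\<sigma> k)) (R (\<sigma> k)))"
      by (simp add: prob_Int_E)
    also have "\<dots> \<le> prob (Z (\<omega> (\<sigma> k)))" using \<omega>(2) Z_borel by (intro finite_measure_mono) auto
    finally show ?thesis .
  qed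
  ultimately show False using PR[of "\<sigma> k"] small by linarith
qed

text \<open>Suppose the sphere carries mass m > 0. Enclose its part K in E in an open set of mass
  less than m * (1 + e). Small cylinders meeting K stay in that set, and each gives the sphere at
  most the fraction 1 - e of its mass, because the pulled-back set is again a sphere. So m is at
  most m * (1 - e) * (1 + e), which is less than m.\<close>

lemma prob_sphere: "prob (sphere p R) = 0"
proof (rule ccontr)
  assume "prob (sphere p R) \<noteq> 0"
  define K where "K = E \<inter> sphere p R"
  define m where "m = prob K"
  have "prob K = prob (sphere p R)" by (simp add: K_def prob_Int_E)
  with \<open>prob (sphere p R) \<noteq> 0\<close> have "m > 0" by (simp add: m_def zero_less_measure_iff)
  obtain e where e: "0 < e" "\<And>p R. prob (sphere p R) \<le> 1 - e" by (rule sphere_gap) blast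
  have "e \<le> 1" using e(2)[of p R] measure_nonneg[of \<mu> "sphere p R"] by linarith
  have K: "compact K" by (simp add: K_def compact_Int_closed compact_E)
  then have K_borel: "K \<in> sets borel" by (intro borel_closed compact_imp_closed)
  have "emeasure \<mu> K < ennreal (m * (1 + e))"
    using \<open>m > 0\<close> e by (simp add: emeasure_eq_measure m_def ennreal_less_iff)
  also have "emeasure \<mu> K = (INF U \<in> {U. K \<subseteq> U \<and> open U}. emeasure \<mu> U)"
    using K_borel by (intro outer_regular) auto
  finally obtain G where G: "K \<subseteq> G" "open G" "emeasure \<mu> G < ennreal (m * (1 + e))"
    by (auto simp: INF_less_iff)
  then have G': "prob G < m * (1 + e)"
    using \<open>m > 0\<close> e by (simp add: emeasure_eq_measure ennreal_less_iff)
  \<comment> \<open>With b = 0 the ball is just its centre, so this places the whole cylinder inside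
    G.\<close>
  obtain n where n: "\<And>w x. w \<in> words \<Longrightarrow> length w = n \<Longrightarrow> cyl w \<inter> K \<noteq> {} \<Longrightarrow> x \<in> cyl w \<Longrightarrow> cball x (ratio w * 0) \<subseteq> G"
    by (rule small_cyl_cover[OF K G(2,1), of 0 1]) auto
  define W where "W = {w \<in> words. length w = n \<and> cyl w \<inter> K \<noteq> {}}"
  have W: "W \<subseteq> {w \<in> words. length w = n}" by (auto simp: W_def)
  have "K = (\<Union>w\<in>W. cyl w \<inter> sphere p R)"
  proof
    show "K \<subseteq> (\<Union>w\<in>W. cyl w \<inter> sphere p R)"
    proof
      fix x assume "x \<in> K"
      then have "x \<in> E" "x \<in> sphere p R" by (auto simp: K_def)
      obtain w where "w \<in> words" "length w = n" "x \<in> cyl w" using \<open>x \<in> E\<close> by (rule E_Union_cyl)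
      then show "x \<in> (\<Union>w\<in>W. cyl w \<inter> sphere p R)"
        using \<open>x \<in> K\<close> \<open>x \<in> sphere p R\<close> by (auto simp: W_def)
    qed
    show "(\<Union>w\<in>W. cyl w \<inter> sphere p R) \<subseteq> K" using cyl_subset_E W by (auto simp: K_def)
  qed
  then have "m = prob (\<Union>w\<in>W. cyl w \<inter> sphere p R)" by (simp add: m_def)
  also have "\<dots> = (\<Sum>w\<in>W. prob (cyl w \<inter> sphere p R))"
    using W by (intro prob_Union_in_cyl) auto
  also have "\<dots> \<le> (\<Sum>w\<in>W. prob (cyl w) * (1 - e))"
  proof (rule sum_mono)
    fix w assume "w \<in> W"
    then have w: "w \<in> words" by (simp add: W_def)
    obtain p' where p': "word_map w -` sphere p R = sphere p' (R / ratio w)"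
      using w by (rule vimage_sphere)
    show "prob (cyl w \<inter> sphere p R) \<le> prob (cyl w) * (1 - e)"
      using w e(2) by (simp add: prob_Int_cyl p' prob_cyl mult_left_mono)
  qed
  also have "\<dots> = (1 - e) * prob (\<Union>w\<in>W. cyl w)"
    using W by (subst prob_Union_in_cyl) (auto simp: sum_distrib_left mult.commute)
  also have "\<dots> \<le> (1 - e) * prob G"
    using n G(2) \<open>e \<le> 1\<close>
    by (intro mult_left_mono finite_measure_mono) (auto simp: W_def)
  also have "\<dots> \<le> (1 - e) * (m * (1 + e))" using G' \<open>e \<le> 1\<close> by (intro mult_left_mono) auto
  also have "\<dots> = m - m * e\<^sup>2" by (simp add: algebra_simps power2_eq_square)
  also have "\<dots> < m" using \<open>m > 0\<close> e(1) by simp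
  finally show False by simp
qed

end

section \<open>The inverse density\<close>

context natural_ifs
begin

text \<open>The indicators of the balls converge at every point off the limiting sphere, which is
  null; dominated convergence does the rest.\<close>

lemma tendsto_prob_cball:
  assumes X: "X \<longlonglongrightarrow> x" and D: "D \<longlonglongrightarrow> d"
  shows "(\<lambda>n. prob (cball (X n) (D n))) \<longlonglongrightarrow> prob (cball x d)"
proof -
  have "(\<lambda>n. integral\<^sup>L \<mu> (indicator (cball (X n) (D n)))) \<longlonglongrightarrow> (integral\<^sup>L \<mu> (indicator (cball x d)) :: real)"
  proof (rule integral_dominated_convergence[where w="\<lambda>_. 1"])
    have "sphere x d \<in> null_sets \<mu>"
      by (intro null_setsI) (auto simp: emeasure_eq_measure prob_sphere)
    then show "AE y in \<mu>. (\<lambda>n. indicator (cball (X n) (D n)) y) \<longlonglongrightarrow> (indicator (cball x d) y :: real)"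
    proof (rule AE_I')
      show "{y \<in> space \<mu>. \<not> (\<lambda>n. indicator (cball (X n) (D n)) y) \<longlonglongrightarrow> (indicator (cball x d) y :: real)}
        \<subseteq> sphere x d"
      proof (rule subsetI, rule ccontr)
        fix y
        assume y: "y \<in> {y \<in> space \<mu>. \<not> (\<lambda>n. indicator (cball (X n) (D n)) y) \<longlonglongrightarrow> (indicator (cball x d) y :: real)}"
          and "y \<notin> sphere x d"
        have lim: "(\<lambda>n. D n - dist (X n) y) \<longlonglongrightarrow> d - dist x y"
          by (intro tendsto_intros X D)
        have "d - dist x y \<noteq> 0" using \<open>y \<notin> sphere x d\<close> by simp
        then have "eventually (\<lambda>n. y \<in> cball (X n) (D n) \<longleftrightarrow> y \<in> cball x d) sequentially"
        proof (cases "d - dist x y > 0")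
          case True
          from order_tendstoD(1)[OF lim this] show ?thesis
            by eventually_elim (use True in auto)
        next
          case False
          then have "d - dist x y < 0" using \<open>d - dist x y \<noteq> 0\<close> by simp
          from order_tendstoD(2)[OF lim this] show ?thesis
            by eventually_elim (use False \<open>d - dist x y \<noteq> 0\<close> in auto)
        qed
        then have "eventually (\<lambda>n. indicator (cball (X n) (D n)) y = (indicator (cball x d) y :: real)) sequentially"
          by eventually_elim (simp add: indicator_def)
        from tendsto_eventually[OF this] show False using y by simp
      qed
    qed
  qed (auto intro!: borel_measurable_indicator)
  then show ?thesis by simp
qed

text \<open>The positive lower bound b keeps the parameter set compact and all ball measures in the
  denominator positive.\<close>

lemma inv_density_max:
  assumes "0 < b" "b \<le> a"
  obtains x d where "x \<in> E" "b \<le> d" "d \<le> a"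
    "\<And>y t. y \<in> E \<Longrightarrow> b \<le> t \<Longrightarrow> t \<le> a \<Longrightarrow> inv_density \<mu> s y t \<le> inv_density \<mu> s x d"
proof -
  have "continuous_on (E \<times> {b..a}) (\<lambda>z. inv_density \<mu> s (fst z) (snd z))"
    unfolding continuous_on_sequentially comp_def
  proof (intro allI ballI impI, elim conjE)
    fix X z assume z: "z \<in> E \<times> {b..a}" and X: "X \<longlonglongrightarrow> z"
    have "prob (cball (fst z) (snd z)) \<noteq> 0"
      using prob_cball_pos[of "fst z" "snd z"] z assms by auto
    then show "(\<lambda>n. inv_density \<mu> s (fst (X n)) (snd (X n))) \<longlonglongrightarrow> inv_density \<mu> s (fst z) (snd z)"
      unfolding inv_density_def using z assms
      by (intro tendsto_divide tendsto_powr tendsto_prob_cball tendsto_mult tendsto_const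
            tendsto_fst tendsto_snd X) auto
  qed
  moreover have "compact (E \<times> {b..a})" by (intro compact_Times compact_E compact_Icc)
  moreover have "E \<times> {b..a} \<noteq> {}" using E_nonempty assms by auto
  ultimately obtain z where "z \<in> E \<times> {b..a}"
    "\<And>t. t \<in> E \<times> {b..a} \<Longrightarrow> inv_density \<mu> s (fst t) (snd t) \<le> inv_density \<mu> s (fst z) (snd z)"
    using continuous_attains_sup[of "E \<times> {b..a}" "\<lambda>z. inv_density \<mu> s (fst z) (snd z)"] by blast
  then show thesis by (intro that[of "fst z" "snd z"]) force+
qed

text \<open>While d is below \<open>a * rmin\<close>, write x = f i y and pass to y with radius d /
  r i. This does not decrease h and does not overshoot a, since \<open>rmin\<close> \<le> r
  i.\<close>

lemma inv_density_le_annulus: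
  assumes "x \<in> E" "0 < d" "d \<le> a"
  obtains x' d' where "x' \<in> E" "a * rmin \<le> d'" "d' \<le> a" "inv_density \<mu> s x d \<le> inv_density \<mu> s x' d'"
proof -
  have "0 < a" using assms by simp
  obtain q where q: "0 < q" "q < 1" "\<And>i. i \<in> letters \<Longrightarrow> r i \<le> q" by (rule rmax_exists) blast
  \<comment> \<open>n bounds the number of enlargements left: each one divides the radius by at most
    q, the largest ratio.\<close>
  have *: "\<exists>x'\<in>E. \<exists>d'. a * rmin \<le> d' \<and> d' \<le> a \<and> inv_density \<mu> s x d \<le> inv_density \<mu> s x' d'"
    if "x \<in> E" "a * q ^ n \<le> d" "d \<le> a" for n x d
    using that
  proof (induction n arbitrary: x d)
    case 0
    have "a * rmin \<le> a" using rmin_less_1 \<open>0 < a\<close> by simp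
    then show ?case using 0 by auto
  next
    case (Suc n)
    show ?case
    proof (cases "a * rmin \<le> d")
      case False
      obtain i y where i: "i \<in> letters" "y \<in> E" "x = f i y" using Suc.prems(1) by (rule E_obtain)
      have ri: "0 < r i" "r i \<le> q" "rmin \<le> r i" using r_pos q rmin_le i by auto
      have "0 < a * q ^ Suc n" using \<open>0 < a\<close> q by simp
      then have d: "0 < d" using Suc.prems(2) by linarith
      have "a * q ^ n * r i \<le> a * q ^ n * q" using ri \<open>0 < a\<close> q by (intro mult_left_mono) auto
      also have "\<dots> \<le> d" using Suc.prems by (simp add: mult_ac)
      finally have 1: "a * q ^ n \<le> d / r i" using ri by (simp add: pos_le_divide_eq)
      have "d \<le> a * r i" using False ri \<open>0 < a\<close> mult_left_mono[of rmin "r i" a] by linarith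
      then have 2: "d / r i \<le> a" using ri by (simp add: pos_divide_le_eq)
      have "inv_density \<mu> s x d \<le> inv_density \<mu> s y (d / r i)"
        using inv_density_f_le[OF i(1,2), of "d / r i"] d ri i(3) by simp
      then show ?thesis using Suc.IH[OF i(2) 1 2] by (meson order_trans)
    qed (use Suc in auto)
  qed
  obtain n where "q ^ n < d / a" using real_arch_pow_inv[of "d / a" q] assms \<open>0 < a\<close> q by auto
  then have "a * q ^ n \<le> d" using \<open>0 < a\<close> by (simp add: field_simps)
  from *[OF assms(1) this assms(3)] show thesis using that by blast
qed

section \<open>Reduction of the packing measure to balls and to premeasures\<close>

lemma packing_measure_le:
  assumes "0 < a" "\<And>x d. x \<in> E \<Longrightarrow> 0 < d \<Longrightarrow> d \<le> a \<Longrightarrow> inv_density \<mu> s x d \<le> M"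
  shows "packing_measure s E \<le> ennreal M"
proof -
  obtain x0 where "x0 \<in> E" using E_nonempty by blast
  have "0 \<le> inv_density \<mu> s x0 a" by (simp add: inv_density_def)
  then have M: "0 \<le> M" using assms(2)[OF \<open>x0 \<in> E\<close> assms(1)] by simp
  \<comment> \<open>At this scale every ball has radius at most a, so no limit in the scale has to
    be taken.\<close>
  have "packing_pre_delta s (2 * a) E \<le> ennreal M" unfolding packing_pre_delta_def
  proof (rule SUP_least)
    fix \<B> assume "\<B> \<in> {\<B>. centered_packing (2 * a) E \<B>}"
    then have P: "disjoint \<B>" "\<And>B. B \<in> \<B> \<Longrightarrow> \<exists>x\<in>E. \<exists>\<rho>>0. B = cball x \<rho>"
      "\<And>B. B \<in> \<B> \<Longrightarrow> diameter B \<le> 2 * a"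
      by (auto simp: centered_packing_def)
    have ball: "B \<in> sets borel \<and> diameter B powr s \<le> M * prob B" if B: "B \<in> \<B>" for B
    proof -
      obtain x \<rho> where x: "x \<in> E" "\<rho> > 0" "B = cball x \<rho>" using P(2)[OF B] by blast
      then have "\<rho> \<le> a" using P(3)[OF B] by simp
      then have "(2 * \<rho>) powr s / prob B \<le> M" using assms(2)[of x \<rho>] x by (simp add: inv_density_def)
      then show ?thesis using prob_cball_pos[of x \<rho>] x by (simp add: pos_divide_le_eq)
    qed
    have "sum (\<lambda>B. ennreal (diameter B powr s)) F \<le> ennreal M" if F: "finite F" "F \<subseteq> \<B>" for F
    proof -
      have "(\<Sum>B\<in>F. diameter B powr s) \<le> (\<Sum>B\<in>F. M * prob B)"
        using ball F by (intro sum_mono) blast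
      also have "\<dots> = M * (\<Sum>B\<in>F. prob B)" by (simp add: sum_distrib_left)
      also have "(\<Sum>B\<in>F. prob B) = prob (\<Union>B\<in>F. B)"
      proof (rule finite_measure_finite_Union[symmetric])
        show "disjoint_family_on (\<lambda>B. B) F" unfolding disjoint_family_on_def
          using F P(1) by (meson disjnt_def pairwiseD subsetD)
      qed (use F ball in auto)
      also have "M * \<dots> \<le> M" using M by (simp add: mult_left_le)
      finally show ?thesis by (subst sum_ennreal) (auto intro: ennreal_leI)
    qed
    then show "(\<Sum>\<^sub>\<infinity>B\<in>\<B>. ennreal (diameter B powr s)) \<le> ennreal M"
      by (subst nonneg_infsum_complete) (auto intro!: SUP_least)
  qed
  then show ?thesis
    using packing_measure_le_premeasure[of s E] packing_premeasure_le[of "2 * a" s E] assms(1)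
    by (meson order_trans zero_less_mult_iff zero_less_numeral)
qed

text \<open>The pieces of a cover need not be measurable. Their closures are, and they still cover
  E, so countable subadditivity makes their measures add up to at least 1.\<close>

lemma packing_measure_ge:
  assumes "\<And>A. A \<subseteq> E \<Longrightarrow> ennreal (H * prob (closure A)) \<le> packing_premeasure s A" "0 \<le> H"
  shows "ennreal H \<le> packing_measure s E"
  unfolding packing_measure_def
proof (rule INF_greatest)
  fix U :: "nat \<Rightarrow> 'a set" assume "U \<in> {U. E \<subseteq> (\<Union>i. U i)}"
  then have U: "E \<subseteq> (\<Union>i. U i)" by simp
  let ?C = "\<lambda>i. closure (U i \<inter> E)"
  have "E \<subseteq> (\<Union>i. ?C i)"
  proof
    fix x assume "x \<in> E"
    then obtain i where "x \<in> U i \<inter> E" using U by blast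
    then have "x \<in> ?C i" using closure_subset by (rule rev_subsetD)
    then show "x \<in> (\<Union>i. ?C i)" by blast
  qed
  moreover have C: "range ?C \<subseteq> sets \<mu>" by (simp add: image_subset_iff)
  ultimately have "emeasure \<mu> E \<le> emeasure \<mu> (\<Union>i. ?C i)" by (intro emeasure_mono sets.countable_UN)
  also have "\<dots> \<le> (\<Sum>i. emeasure \<mu> (?C i))" using C by (rule emeasure_subadditive_countably)
  finally have "ennreal H \<le> ennreal H * (\<Sum>i. emeasure \<mu> (?C i))"
    using mult_left_mono[of 1 "\<Sum>i. emeasure \<mu> (?C i)" "ennreal H"] by (simp add: emeasure_E)
  also have "\<dots> = (\<Sum>i. ennreal (H * prob (?C i)))"
    using assms(2) by (simp add: emeasure_eq_measure ennreal_mult)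
  also have "\<dots> \<le> (\<Sum>i. packing_premeasure s (U i))"
  proof (rule suminf_le)
    fix i
    have "ennreal (H * prob (?C i)) \<le> packing_premeasure s (U i \<inter> E)" by (rule assms) simp
    also have "\<dots> \<le> packing_premeasure s (U i)" by (rule packing_premeasure_mono) simp
    finally show "ennreal (H * prob (?C i)) \<le> packing_premeasure s (U i)" .
  qed auto
  finally show "ennreal H \<le> (\<Sum>i. packing_premeasure s (U i))" .
qed

end

section \<open>Lower bound for the packing measure\<close>

context natural_ifs
begin

text \<open>Finiteness keeps the union closed, so that packing can continue in its open complement.
  The last condition converts the measure covered into a lower bound for the packing sum.\<close>

definition dense_packing :: "real \<Rightarrow> real \<Rightarrow> 'a set \<Rightarrow> 'a set set \<Rightarrow> bool" where
  "dense_packing H \<delta> A \<B> \<longleftrightarrow> finite \<B> \<and> disjoint \<B> \<and>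
     (\<forall>B\<in>\<B>. (\<exists>y\<in>A. \<exists>\<rho>>0. B = cball y \<rho>) \<and> diameter B \<le> \<delta> \<and> H * prob B \<le> diameter B powr s)"

lemma prob_Union_dense_packing:
  assumes "dense_packing H \<delta> A \<B>"
  shows "prob (\<Union>\<B>) = (\<Sum>B\<in>\<B>. prob B)"
proof -
  have "prob (\<Union>B\<in>\<B>. B) = (\<Sum>B\<in>\<B>. prob B)"
  proof (rule finite_measure_finite_Union)
    show "disjoint_family_on (\<lambda>B. B) \<B>"
      using assms unfolding disjoint_family_on_def dense_packing_def by (meson disjnt_def pairwiseD)
  qed (use assms in \<open>auto simp: dense_packing_def\<close>)
  then show ?thesis by simp
qed

lemma dense_packing_le_pre_delta:
  assumes "dense_packing H \<delta> A \<B>" "0 \<le> H"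
  shows "ennreal (H * prob (\<Union>\<B>)) \<le> packing_pre_delta s \<delta> A"
proof -
  have P: "finite \<B>" "centered_packing \<delta> A \<B>"
    "\<And>B. B \<in> \<B> \<Longrightarrow> H * prob B \<le> diameter B powr s"
    using assms by (auto simp: dense_packing_def centered_packing_def countable_finite)
  have "H * prob (\<Union>\<B>) \<le> (\<Sum>B\<in>\<B>. diameter B powr s)"
    unfolding prob_Union_dense_packing[OF assms(1)] sum_distrib_left using P by (intro sum_mono)
  then have "ennreal (H * prob (\<Union>\<B>)) \<le> (\<Sum>B\<in>\<B>. ennreal (diameter B powr s))"
    by (simp add: ennreal_leI)
  also have "\<dots> = (\<Sum>\<^sub>\<infinity>B\<in>\<B>. ennreal (diameter B powr s))" using P by simp
  also have "\<dots> \<le> packing_pre_delta s \<delta> A"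
    unfolding packing_pre_delta_def using P by (intro SUP_upper) auto
  finally show ?thesis .
qed

text \<open>In each small cylinder \<open>w\<close> meeting the part of \<open>closure A\<close> to be covered, copy the ball
  \<open>cball x d\<close>, shrunk to radius \<open>D\<close>, by \<open>word_map w\<close>, with its centre moved to a point of \<open>A\<close> in the cylinder
  \<open>w @ u\<close>. This fails only if \<open>w @ u\<close> misses \<open>closure A\<close>; such \<open>w @ u\<close> lie in a set of small
  measure, hence so do the corresponding \<open>w\<close>.\<close>

lemma dense_packing_in_open:
  assumes A: "A \<subseteq> E" and V: "open V" and "0 < prob (closure A \<inter> V)" and "0 < \<delta>"
    and D: "0 < D" "2 * D < c" and u: "u \<in> words" "\<And>y. y \<in> cyl u \<Longrightarrow> cball y D \<subseteq> cball x d"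
    "ratio u * diameter E \<le> D"
    and H: "0 \<le> H" "H * prob (cball x d) \<le> (2 * D) powr s"
  obtains \<B> where "dense_packing H \<delta> A \<B>" "\<Union>\<B> \<subseteq> V"
    "ratio u powr s / 4 * prob (closure A \<inter> V) \<le> prob (\<Union>\<B>)"
proof -
  define m where "m = prob (closure A \<inter> V)"
  \<comment> \<open>The fraction of the mass of \<open>cyl w\<close> carried by
    \<open>cyl (w @ u)\<close>, the same for every w.\<close>
  define k where "k = ratio u powr s"
  have m: "m > 0" using assms by (simp add: m_def)
  have k: "k > 0" using ratio_pos[OF u(1)] by (simp add: k_def)
  have AE: "closure A \<subseteq> E" using A compact_imp_closed[OF compact_E] by (rule closure_minimal)
  have "ennreal (m / 2) < emeasure \<mu> (closure A \<inter> V)"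
    using m by (simp add: emeasure_eq_measure m_def ennreal_less_iff)
  also have "\<dots> = (SUP K \<in> {K. K \<subseteq> closure A \<inter> V \<and> compact K}. emeasure \<mu> K)"
    using V by (intro inner_regular) auto
  finally obtain K where K: "K \<subseteq> closure A \<inter> V" "compact K" "ennreal (m / 2) < emeasure \<mu> K"
    by (auto simp: less_SUP_iff)
  have mK: "m / 2 < prob K" using K(3) m by (simp add: emeasure_eq_measure ennreal_less_iff)
  have K_borel: "K \<in> sets borel" using K(2) by (intro borel_closed compact_imp_closed)
  \<comment> \<open>The subcylinders \<open>w @ u\<close> that miss K lie in the excess of G over K.
    Allowing it only half of \<open>k * prob K\<close> leaves the other half to the good words; with
    \<open>m / 2 < prob K\<close> this yields the factor 1 / 4.\<close>
  have "emeasure \<mu> K < ennreal (prob K + k * prob K / 2)"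
    using mK m k by (simp add: emeasure_eq_measure ennreal_less_iff)
  also have "emeasure \<mu> K = (INF U \<in> {U. K \<subseteq> U \<and> open U}. emeasure \<mu> U)"
    using K_borel by (intro outer_regular) auto
  finally obtain G0 where G0: "K \<subseteq> G0" "open G0" "emeasure \<mu> G0 < ennreal (prob K + k * prob K / 2)"
    by (auto simp: INF_less_iff)
  define G where "G = G0 \<inter> V"
  have G: "K \<subseteq> G" "open G" "G \<subseteq> V" using G0 K(1) V by (auto simp: G_def)
  have "prob G \<le> prob G0" using G0 V by (intro finite_measure_mono) (auto simp: G_def)
  moreover have "prob G0 < prob K + k * prob K / 2"
    using G0(3) mK m k by (simp add: emeasure_eq_measure ennreal_less_iff del: ennreal_plus)
  ultimately have probG: "prob G - prob K \<le> k * prob K / 2" by simp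
  obtain n where n: "\<And>w. w \<in> words \<Longrightarrow> length w = n \<Longrightarrow> ratio w * D < \<delta> / 2"
    "\<And>w x. w \<in> words \<Longrightarrow> length w = n \<Longrightarrow> cyl w \<inter> K \<noteq> {} \<Longrightarrow> x \<in> cyl w \<Longrightarrow> cball x (ratio w * D) \<subseteq> G"
    using D \<open>0 < \<delta>\<close> by (rule_tac small_cyl_cover[OF K(2) G(2,1), of D "\<delta> / 2"]) auto
  define W where "W = {w \<in> words. length w = n \<and> cyl w \<inter> K \<noteq> {}}"
  define good where "good = {w \<in> W. cyl (w @ u) \<inter> K \<noteq> {}}"
  define bad where "bad = W - good"
  have Wn: "W \<subseteq> {w \<in> words. length w = n}" by (auto simp: W_def)
  have fin: "finite W" using Wn finite_words_length by (rule finite_subset)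
  have gb: "good \<subseteq> W" "bad \<subseteq> W" "finite good" "finite bad"
    using fin by (auto simp: good_def bad_def)
  \<comment> \<open>A point of K is a limit of points of A, and points of E close enough to a
    cylinder belong to it.\<close>
  have "\<exists>y. y \<in> A \<and> y \<in> cyl (w @ u)" if w: "w \<in> good" for w
  proof -
    obtain p where p: "p \<in> cyl (w @ u)" "p \<in> K" using w by (auto simp: good_def)
    have wu: "w @ u \<in> words" using w u(1) by (simp add: good_def W_def)
    have "p \<in> closure A" "0 < c * ratio (w @ u)" using p K(1) c_pos ratio_pos[OF wu] by auto
    then obtain y where y: "y \<in> A" "dist y p < c * ratio (w @ u)" by (meson closure_approachable)
    then show ?thesis using mem_cyl_if_close[OF wu p(1), of y] A by (auto simp: dist_commute)
  qed
  then obtain y where y: "\<And>w. w \<in> good \<Longrightarrow> y w \<in> A" "\<And>w. w \<in> good \<Longrightarrow> y w \<in> cyl (w @ u)"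
    by metis
  define B where "B w = cball (y w) (ratio w * D)" for w
  have good: "w \<in> words" "length w = n" "cyl w \<inter> K \<noteq> {}" "y w \<in> cyl w" "ratio w > 0" if "w \<in> good" for w
    using that y(2)[OF that] cyl_append_subset[OF u(1), of w] ratio_pos[of w]
    by (auto simp: good_def W_def)
  \<comment> \<open>The distance of the centres is at least \<open>c * ratio w\<close> and at least
    \<open>c * ratio v\<close>, hence at least their mean, which exceeds the sum of the radii
    because 2 * D < c.\<close>
  have B_disj: "B w \<inter> B v = {}" if wv: "w \<in> good" "v \<in> good" "w \<noteq> v" for w v
  proof (rule ccontr)
    assume "B w \<inter> B v \<noteq> {}"
    then obtain z where "dist (y w) z \<le> ratio w * D" "dist (y v) z \<le> ratio v * D"
      by (auto simp: B_def)
    then have "dist (y w) (y v) \<le> (ratio w + ratio v) * D"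
      using dist_triangle2[of "y w" "y v" z] by (simp add: distrib_right)
    moreover have "c * ratio w \<le> dist (y w) (y v)" "c * ratio v \<le> dist (y w) (y v)"
      using cyl_gap[of w v "y w" "y v"] cyl_gap[of v w "y v" "y w"] good wv
      by (auto simp: dist_commute)
    moreover have "(ratio w + ratio v) * (2 * D) < (ratio w + ratio v) * c"
      using D(2) good(5)[OF wv(1)] good(5)[OF wv(2)] by (intro mult_strict_left_mono) auto
    ultimately show False by (simp add: algebra_simps)
  qed
  \<comment> \<open>Pulled back by \<open>word_map w\<close>, the ball becomes
    \<open>cball y' D\<close> inside \<open>cball x d\<close>, which bounds its measure above. Its
    radius exceeds or equals the diameter bound for \<open>cyl (w @ u)\<close>, which bounds its
    measure below.\<close>
  have B_meas: "H * prob (B w) \<le> (2 * (ratio w * D)) powr s"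
    "k * prob (cyl w) \<le> prob (B w)" if w: "w \<in> good" for w
  proof -
    note gw = good[OF w]
    obtain y' where y': "y' \<in> cyl u" "y w = word_map w y'"
      using y(2)[OF w] by (auto simp: cyl_append)
    have "y' \<in> E" using y'(1) cyl_subset_E[OF u(1)] by blast
    moreover have "D < c" using D by simp
    ultimately have "cball (word_map w y') (ratio w * D) \<inter> E \<subseteq> cyl w"
      by (intro cball_Int_E_subset_cyl gw)
    then have "prob (B w) = ratio w powr s * prob (cball y' D)"
      unfolding B_def y'(2) by (intro prob_cball_word_map gw)
    also have "\<dots> \<le> ratio w powr s * prob (cball x d)"
      using u(2)[OF y'(1)] by (intro mult_left_mono finite_measure_mono) auto
    finally have "H * prob (B w) \<le> ratio w powr s * (H * prob (cball x d))"
      using H(1) by (simp add: mult_left_mono mult.left_commute)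
    also have "\<dots> \<le> ratio w powr s * (2 * D) powr s" using H(2) by (intro mult_left_mono) auto
    also have "\<dots> = (2 * (ratio w * D)) powr s"
      using gw(5) D by (simp add: powr_mult[symmetric] mult_ac)
    finally show "H * prob (B w) \<le> (2 * (ratio w * D)) powr s" .
    have wu: "w @ u \<in> words" using gw u by simp
    have "cyl (w @ u) \<subseteq> B w"
    proof
      fix z assume "z \<in> cyl (w @ u)"
      then have "dist (y w) z \<le> ratio w * (ratio u * diameter E)"
        using diam_cyl[OF wu y(2)[OF w]] by (simp add: ratio_append mult_ac)
      also have "\<dots> \<le> ratio w * D" using u(3) gw(5) by (intro mult_left_mono) auto
      finally show "z \<in> B w" by (simp add: B_def)
    qed
    then have "prob (cyl (w @ u)) \<le> prob (B w)" by (intro finite_measure_mono) (auto simp: B_def)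
    moreover have "prob (cyl (w @ u)) = k * prob (cyl w)"
      using wu gw u(1) ratio_pos[OF u(1)] by (simp add: prob_cyl ratio_append powr_mult k_def mult_ac)
    ultimately show "k * prob (cyl w) \<le> prob (B w)" by simp
  qed
  have "(\<Sum>w\<in>bad. k * prob (cyl w)) = (\<Sum>w\<in>bad. prob (cyl (w @ u)))"
  proof (rule sum.cong)
    fix w assume "w \<in> bad"
    then have "w \<in> words" using gb(2) Wn by blast
    then show "k * prob (cyl w) = prob (cyl (w @ u))"
      using u(1) ratio_pos[of w] ratio_pos[OF u(1)]
      by (simp add: prob_cyl ratio_append powr_mult k_def mult_ac)
  qed simp
  also have "\<dots> = prob (\<Union>w\<in>bad. cyl (w @ u))"
    using gb(2) Wn u(1) cyl_append_subset[OF u(1)]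
    by (intro prob_Union_in_cyl[symmetric, where n=n]) auto
  also have "\<dots> \<le> prob (G - K)"
  proof (rule finite_measure_mono)
    show "(\<Union>w\<in>bad. cyl (w @ u)) \<subseteq> G - K"
    proof (rule UN_least)
      fix w assume w: "w \<in> bad"
      have wW: "w \<in> words" "length w = n" "cyl w \<inter> K \<noteq> {}" using w gb(2) by (auto simp: W_def)
      have "z \<in> G" if "z \<in> cyl w" for z
        using n(2)[OF wW that] ratio_pos[OF wW(1)] D(1) by (auto simp: subset_iff)
      then have "cyl w \<subseteq> G" by blast
      moreover have "cyl (w @ u) \<inter> K = {}" using w by (auto simp: bad_def good_def)
      ultimately show "cyl (w @ u) \<subseteq> G - K" using cyl_append_subset[OF u(1), of w] by blast
    qed
  qed (use G K_borel in auto)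
  also have "\<dots> = prob G - prob K" using G K_borel by (intro finite_measure_Diff) auto
  finally have bad_le: "(\<Sum>w\<in>bad. k * prob (cyl w)) \<le> k * prob K / 2" using probG by linarith
  have "K \<subseteq> (\<Union>w\<in>W. cyl w)"
  proof
    fix z assume z: "z \<in> K"
    then have "z \<in> E" using K(1) AE by blast
    then obtain w where "w \<in> words" "length w = n" "z \<in> cyl w" by (rule E_Union_cyl)
    then show "z \<in> (\<Union>w\<in>W. cyl w)" using z by (auto simp: W_def)
  qed
  moreover have cW: "(\<Union>w\<in>W. cyl w) \<in> sets borel" using Wn fin by (intro sets.finite_UN) auto
  ultimately have "prob K \<le> prob (\<Union>w\<in>W. cyl w)" by (intro finite_measure_mono) auto
  also have "\<dots> = (\<Sum>w\<in>W. prob (cyl w))" using Wn by (intro prob_Union_in_cyl) auto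
  finally have "k * prob K \<le> (\<Sum>w\<in>W. k * prob (cyl w))"
    using k by (simp add: sum_distrib_left[symmetric])
  also have "\<dots> = (\<Sum>w\<in>bad. k * prob (cyl w)) + (\<Sum>w\<in>good. k * prob (cyl w))"
    unfolding bad_def by (rule sum.subset_diff[OF gb(1) fin])
  finally have "k * prob K / 2 \<le> (\<Sum>w\<in>good. k * prob (cyl w))" using bad_le by linarith
  also have "\<dots> \<le> (\<Sum>w\<in>good. prob (B w))" by (intro sum_mono B_meas)
  also have "\<dots> = prob (\<Union>w\<in>good. B w)"
    using gb(3) B_disj
    by (intro finite_measure_finite_Union[symmetric]) (auto simp: disjoint_family_on_def B_def)
  finally have "k * prob K / 2 \<le> prob (\<Union>(B ` good))" .
  moreover have "k * (m / 2) \<le> k * prob K" using mK k by (intro mult_left_mono) auto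
  ultimately have "k / 4 * m \<le> prob (\<Union>(B ` good))" by simp
  moreover have "dense_packing H \<delta> A (B ` good)" unfolding dense_packing_def
  proof (intro conjI ballI)
    show "finite (B ` good)" using gb by simp
    show "disjoint (B ` good)"
      using B_disj unfolding pairwise_def disjnt_def by (metis (no_types, lifting) imageE)
    fix b assume "b \<in> B ` good"
    then obtain w where w: "w \<in> good" "b = B w" by blast
    have pos: "0 < ratio w * D" using good(5)[OF w(1)] D by simp
    show "\<exists>y\<in>A. \<exists>\<rho>>0. b = cball y \<rho>" using w y pos by (auto simp: B_def)
    show "diameter b \<le> \<delta>" using n(1)[OF good(1,2)[OF w(1)]] pos w by (simp add: B_def)
    show "H * prob b \<le> diameter b powr s" using B_meas(1)[OF w(1)] pos w by (simp add: B_def)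
  qed
  moreover have "\<Union>(B ` good) \<subseteq> V"
  proof (rule UN_least)
    fix w assume "w \<in> good"
    then show "B w \<subseteq> V" using n(2)[of w "y w"] good[of w] G(3) unfolding B_def by blast
  qed
  ultimately show thesis using that unfolding k_def m_def by blast
qed

text \<open>If the supremum of the covered measures were below m, every packing would leave at least
  the difference uncovered, and a fixed fraction k of the remainder could be added. A packing within
  k times the difference of the supremum could then be improved beyond it.\<close>

lemma dense_packing_exhausts:
  assumes A: "A \<subseteq> E" and "0 < \<delta>"
    and D: "0 < D" "2 * D < c" and u: "u \<in> words" "\<And>y. y \<in> cyl u \<Longrightarrow> cball y D \<subseteq> cball x d"
    "ratio u * diameter E \<le> D"
    and H: "0 \<le> H" "H * prob (cball x d) \<le> (2 * D) powr s"
    and \<theta>: "\<theta> < prob (closure A)"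
  obtains \<B> where "dense_packing H \<delta> A \<B>" "\<theta> < prob (\<Union>\<B>)"
proof -
  define X where "X = {prob (\<Union>\<B>) | \<B>. dense_packing H \<delta> A \<B>}"
  have "dense_packing H \<delta> A {}" by (simp add: dense_packing_def)
  then have "X \<noteq> {}" by (auto simp: X_def)
  have bdd: "bdd_above X" by (intro bdd_aboveI[of _ 1]) (auto simp: X_def)
  define m where "m = prob (closure A)"
  define k where "k = ratio u powr s / 4"
  have k: "k > 0" using ratio_pos[OF u(1)] by (simp add: k_def)
  have "m \<le> Sup X"
  proof (rule ccontr)
    assume "\<not> m \<le> Sup X"
    then have less: "Sup X < m" by simp
    then have "Sup X - k * (m - Sup X) < Sup X" using k by simp
    then obtain t where "t \<in> X" "Sup X - k * (m - Sup X) < t"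
      using less_cSupE[OF _ \<open>X \<noteq> {}\<close>] by blast
    then obtain \<B> where \<B>: "dense_packing H \<delta> A \<B>" "Sup X - k * (m - Sup X) < prob (\<Union>\<B>)"
      by (auto simp: X_def)
    have le: "prob (\<Union>\<C>) \<le> Sup X" if "dense_packing H \<delta> A \<C>" for \<C>
      using that bdd by (intro cSup_upper) (auto simp: X_def)
    have closed: "closed (\<Union>\<B>)"
    proof (rule closed_Union)
      show "finite \<B>" using \<B>(1) by (simp add: dense_packing_def)
      show "\<forall>B\<in>\<B>. closed B" using \<B>(1) by (auto simp: dense_packing_def)
    qed
    have "prob (closure A) \<le> prob (closure A \<inter> - \<Union>\<B> \<union> \<Union>\<B>)"
      using closed by (intro finite_measure_mono) auto
    also have "\<dots> \<le> prob (closure A \<inter> - \<Union>\<B>) + prob (\<Union>\<B>)"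
      using closed by (intro measure_subadditive) auto
    finally have rest: "m - Sup X \<le> prob (closure A \<inter> - \<Union>\<B>)"
      using le[OF \<B>(1)] by (simp add: m_def)
    then have "0 < prob (closure A \<inter> - \<Union>\<B>)" using less by linarith
    then obtain \<C> where \<C>: "dense_packing H \<delta> A \<C>" "\<Union>\<C> \<subseteq> - \<Union>\<B>"
      "k * prob (closure A \<inter> - \<Union>\<B>) \<le> prob (\<Union>\<C>)"
      using dense_packing_in_open[OF A _ _ \<open>0 < \<delta>\<close> D u H, of "- \<Union>\<B>"] closed
      unfolding k_def by (metis open_Compl)
    have un: "dense_packing H \<delta> A (\<B> \<union> \<C>)"
    proof -
      have "disjoint (\<B> \<union> \<C>)"
      proof (rule disjoint_union)
        show "disjoint \<B>" "disjoint \<C>" using \<B>(1) \<C>(1) by (auto simp: dense_packing_def)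
        show "\<Union>\<B> \<inter> \<Union>\<C> = {}" using \<C>(2) by blast
      qed
      then show ?thesis using \<B>(1) \<C>(1) by (auto simp: dense_packing_def)
    qed
    have C_closed: "closed (\<Union>\<C>)"
    proof (rule closed_Union)
      show "finite \<C>" using \<C>(1) by (simp add: dense_packing_def)
      show "\<forall>B\<in>\<C>. closed B" using \<C>(1) by (auto simp: dense_packing_def)
    qed
    have "k * (m - Sup X) \<le> prob (\<Union>\<C>)"
      using \<C>(3) rest k by (meson less_imp_le mult_left_mono order_trans)
    then have "Sup X < prob (\<Union>\<B>) + prob (\<Union>\<C>)" using \<B>(2) by linarith
    also have "\<dots> = prob (\<Union>\<B> \<union> \<Union>\<C>)"
      using \<C>(2) closed C_closed by (intro finite_measure_Union[symmetric]) auto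
    also have "\<dots> \<le> Sup X" using le[OF un] by simp
    finally show False by simp
  qed
  then have "\<theta> < Sup X" using \<theta> by (simp add: m_def)
  then obtain t where "t \<in> X" "\<theta> < t" using less_cSupE[OF _ \<open>X \<noteq> {}\<close>] by blast
  then show thesis using that by (auto simp: X_def)
qed

lemma less_inv_density_le_packing_measure:
  assumes x: "x \<in> E" and d: "0 < d" "2 * d < c" and H: "0 \<le> H" "H < inv_density \<mu> s x d"
  shows "ennreal H \<le> packing_measure s E"
proof (rule packing_measure_ge[OF _ H(1)])
  fix A assume A: "A \<subseteq> E"
  have p: "0 < prob (cball x d)" using x d by (intro prob_cball_pos)
  obtain D where D: "0 < D" "D < d" "H < (2 * D) powr s / prob (cball x d)"
    using powr_divide_gt_shrink[of H d s "prob (cball x d)"] H(2) p d by (auto simp: inv_density_def)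
  have HD: "H * prob (cball x d) \<le> (2 * D) powr s" using D(3) p by (simp add: pos_less_divide_eq)
  \<comment> \<open>The bound d - D lets the centre move anywhere in \<open>cyl u\<close> without
    \<open>cball y D\<close> leaving \<open>cball x d\<close>; the bound D makes a ball around such
    a centre contain the whole cylinder.\<close>
  obtain n where n: "\<And>w. w \<in> words \<Longrightarrow> length w = n \<Longrightarrow> ratio w * diameter E < min D (d - D)"
    "\<And>w x y. w \<in> words \<Longrightarrow> length w = n \<Longrightarrow> x \<in> cyl w \<Longrightarrow> y \<in> cyl w \<Longrightarrow> dist x y < min D (d - D)"
    using D by (rule_tac long_cyl_small[of "min D (d - D)" "diameter E"]) (auto simp: diameter_E_nonneg)
  obtain u where u: "u \<in> words" "length u = n" "x \<in> cyl u" using x by (rule E_Union_cyl)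
  have ball: "cball y D \<subseteq> cball x d" if "y \<in> cyl u" for y
  proof
    fix z assume "z \<in> cball y D"
    moreover have "dist x y < d - D" using n(2)[OF u(1,2,3) that] by simp
    ultimately show "z \<in> cball x d" using dist_triangle[of x z y] by simp
  qed
  have rat: "ratio u * diameter E \<le> D" using n(1)[OF u(1,2)] by simp
  have "2 * D < c" using D d by simp
  have le: "ennreal (H * \<theta>) \<le> packing_premeasure s A" if \<theta>: "\<theta> < prob (closure A)" for \<theta>
  proof (rule packing_premeasure_ge)
    fix \<delta> :: real assume \<delta>: "0 < \<delta>"
    obtain \<B> where \<B>: "dense_packing H \<delta> A \<B>" "\<theta> < prob (\<Union>\<B>)"
      by (rule dense_packing_exhausts[OF A \<delta> D(1) \<open>2 * D < c\<close> u(1) ball rat H(1) HD \<theta>])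
    have "ennreal (H * \<theta>) \<le> ennreal (H * prob (\<Union>\<B>))"
      using \<B>(2) H(1) by (intro ennreal_leI mult_left_mono) auto
    also have "\<dots> \<le> packing_pre_delta s \<delta> A" using dense_packing_le_pre_delta[OF \<B>(1) H(1)] .
    finally show "ennreal (H * \<theta>) \<le> packing_pre_delta s \<delta> A" .
  qed
  have "(\<lambda>n. prob (closure A) + - inverse (real (Suc n))) \<longlonglongrightarrow> prob (closure A)"
    using LIMSEQ_inverse_real_of_nat_add_minus .
  then have "(\<lambda>n. ennreal (H * (prob (closure A) + - inverse (real (Suc n))))) \<longlonglongrightarrow> ennreal (H * prob (closure A))"
    by (intro tendsto_intros)
  then show "ennreal (H * prob (closure A)) \<le> packing_premeasure s A"
    by (rule LIMSEQ_le_const2) (use le in auto)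
qed

lemma inv_density_le_packing_measure:
  assumes x: "x \<in> E" and d: "0 < d" "d \<le> c / rmin"
  shows "ennreal (inv_density \<mu> s x d) \<le> packing_measure s E"
proof -
  have *: "ennreal H \<le> packing_measure s E" if H: "0 \<le> H" "H < inv_density \<mu> s x d" for H
  proof -
    have p: "0 < prob (cball x d)" using x d by (intro prob_cball_pos)
    \<comment> \<open>Shrinking makes \<open>rmin * D < c\<close> strict even when d =
      \<open>c / rmin\<close>. The smaller ball has smaller measure, so h at radius D still exceeds
      H.\<close>
    obtain D where D: "0 < D" "D < d" "H < (2 * D) powr s / prob (cball x d)"
      using powr_divide_gt_shrink[of H d s "prob (cball x d)"] H(2) p d by (auto simp: inv_density_def)
    note D(3)
    also have "(2 * D) powr s / prob (cball x d) \<le> inv_density \<mu> s x D" unfolding inv_density_def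
      using prob_cball_pos[OF x D(1)] D by (intro frac_le finite_measure_mono) auto
    finally have H1: "H < inv_density \<mu> s x D" .
    obtain i where i: "i \<in> letters" "r i = rmin" by (rule rmin_attained)
    have "rmin * D < rmin * d" using D(2) rmin_pos by simp
    also have "\<dots> \<le> c" using d rmin_pos by (simp add: pos_le_divide_eq mult.commute)
    finally have small: "rmin * D < c" .
    have "cball (f i x) (r i * D) \<inter> E \<subseteq> f i ` E"
    proof
      fix z assume z: "z \<in> cball (f i x) (r i * D) \<inter> E"
      then obtain j y where j: "j \<in> letters" "y \<in> E" "z = f j y" by (meson E_obtain IntD2)
      have "j = i"
        using c_le_dist[OF i(1) j(1) _ x j(2)] z j(3) small i(2) by (cases "j = i") auto
      then show "z \<in> f i ` E" using j by blast
    qed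
    then have "inv_density \<mu> s (f i x) (r i * D) = inv_density \<mu> s x D"
      using inv_density_word_map[of "[i]" x D] i(1) D(1) by (simp add: cyl_Cons)
    then have H2: "H < inv_density \<mu> s (f i x) (rmin * D)" using H1 i(2) by simp
    have fx: "f i x \<in> E" using i x by (intro f_in_E)
    have pos: "0 < rmin * D" using rmin_pos D by simp
    \<comment> \<open>With the radius below c, applying any further word preserves h; a long word
      brings the radius below c / 2, as the packing construction demands.\<close>
    obtain n where n: "\<And>w. w \<in> words \<Longrightarrow> length w = n \<Longrightarrow> ratio w * (rmin * D) < c / 2"
      using c_pos pos by (rule_tac long_cyl_small[of "c / 2" "rmin * D"]) auto
    define w where "w = replicate n i"
    have w: "w \<in> words" "length w = n" using i(1) by (auto simp: w_def words_def)
    have "inv_density \<mu> s (word_map w (f i x)) (ratio w * (rmin * D)) = inv_density \<mu> s (f i x) (rmin * D)"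
      using w fx small pos by (intro inv_density_word_map cball_Int_E_subset_cyl)
    then have H3: "H < inv_density \<mu> s (word_map w (f i x)) (ratio w * (rmin * D))" using H2 by simp
    show ?thesis
    proof (rule less_inv_density_le_packing_measure[OF _ _ _ H(1) H3])
      show "word_map w (f i x) \<in> E" using fx cyl_subset_E[OF w(1)] by (auto simp: cyl_def)
      show "0 < ratio w * (rmin * D)" using ratio_pos[OF w(1)] pos by simp
      show "2 * (ratio w * (rmin * D)) < c" using n[OF w] by simp
    qed
  qed
  show ?thesis
  proof (rule dense_le)
    fix t assume t: "t < ennreal (inv_density \<mu> s x d)"
    then obtain H where H: "t = ennreal H" "0 \<le> H" by (cases t) auto
    then show "t \<le> packing_measure s E" using * t by (simp add: ennreal_less_iff)
  qed
qed

end

section \<open>The packing measure as a maximum\<close>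

theorem theorem1:
  fixes N :: nat and f :: "nat \<Rightarrow> real ^ 'n \<Rightarrow> real ^ 'n" and r :: "nat \<Rightarrow> real"
    and E :: "(real ^ 'n) set" and s a :: real and \<mu> :: "(real ^ 'n) measure"
  assumes "similitude_system N f r"
    and "self_similar_set N f E"
    and "strong_separation N f E"
    and "similarity_dimension N r s"
    and "natural_measure N f r s E \<mu>"
    and "0 < a" and "a \<le> separation_const N f E / min_ratio N r"
  shows "\<exists>M::real. packing_measure s E = ennreal M \<and>
           is_maximum {inv_density \<mu> s x d | x d. x \<in> E \<and> 0 < d \<and> d \<le> a} M \<and>
           is_maximum {inv_density \<mu> s x d | x d. x \<in> E \<and> a * min_ratio N r \<le> d \<and> d \<le> a} M"
proof -
  interpret natural_ifs N f r E s \<mu>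
    by unfold_locales (use assms in auto)
  let ?h = "inv_density \<mu> s"
  have a: "0 < a * rmin" "a * rmin \<le> a" using assms(6) rmin_pos rmin_less_1 by auto
  obtain x d where x: "x \<in> E" "a * rmin \<le> d" "d \<le> a"
    and max: "\<And>y t. y \<in> E \<Longrightarrow> a * rmin \<le> t \<Longrightarrow> t \<le> a \<Longrightarrow> ?h y t \<le> ?h x d"
    using inv_density_max[OF a] by blast
  have d: "0 < d" using a x by linarith
  have max': "?h y t \<le> ?h x d" if yt: "y \<in> E" "0 < t" "t \<le> a" for y t
  proof -
    obtain y' t' where "y' \<in> E" "a * rmin \<le> t'" "t' \<le> a" "?h y t \<le> ?h y' t'"
      using yt by (rule inv_density_le_annulus)
    then show ?thesis using max[of y' t'] by simp
  qed
  have "packing_measure s E = ennreal (?h x d)"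
  proof (rule antisym)
    show "packing_measure s E \<le> ennreal (?h x d)" using assms(6) max' by (rule packing_measure_le)
    show "ennreal (?h x d) \<le> packing_measure s E"
      using x d assms(7) by (intro inv_density_le_packing_measure) auto
  qed
  then show ?thesis using x d max max' by (intro exI[of _ "?h x d"]) (auto simp: is_maximum_def)
qed

end
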